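(* Let $E$ be a finite set with $n=|E|$ elements and let $\nu\colon 2^{E}\to\mathbb{R}\cup\{-\infty\}$ be an $\mathrm{M}^\natural$-concave function. For $0\le k\le n$ and $0<q\le 1$ set $I_{q,\nu;k}=\sum_{I\subseteq E,\,|I|=k} q^{-\nu(I)}$. Then \[ I_{q,\nu;k}^2 \geq \Big(1+\frac1k\Big)\Big(1+\frac1{n-k}\Big) I_{q,\nu;k-1}I_{q,\nu;k+1}\quad\text{for all } 0<k<n \text{ and } 0<q\le 1. \]
   Context: A function $\nu\colon 2^E\to\mathbb{R}\cup\{-\infty\}$ is $\mathrm{M}^\natural$-concave if for any $I_1,I_2\subseteq E$ and $i_1\in I_1\setminus I_2$, either $\nu(I_1)+\nu(I_2)\le \nu(I_1\setminus i_1)+\nu(I_2\cup i_1)$, or there is $i_2\in I_2\setminus I_1$ with $\nu(I_1)+\nu(I_2)\le \nu((I_1\setminus i_1)\cup i_2)+\nu((I_2\setminus i_2)\cup i_1)$. Its effective domain $\{I:\nu(I)\ne-\infty\}$ is assumed nonempty. Convention: $q^{\infty}=0$, i.e. $q^{-\nu(I)}=0$ when $\nu(I)=-\infty$. *)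

theory Defs
  imports "HOL-Analysis.Analysis" "HOL-Library.Extended_Real"
begin

definition M_natural_concave :: "'a set \<Rightarrow> ('a set \<Rightarrow> ereal) \<Rightarrow> bool" where
  "M_natural_concave E \<nu> \<longleftrightarrow>
     (\<forall>I. I \<subseteq> E \<longrightarrow> \<nu> I \<noteq> \<infinity>) \<and>
     (\<exists>I. I \<subseteq> E \<and> \<nu> I \<noteq> -\<infinity>) \<and>
     (\<forall>I1 I2 i1. I1 \<subseteq> E \<longrightarrow> I2 \<subseteq> E \<longrightarrow> i1 \<in> I1 - I2 \<longrightarrow>
        (\<nu> I1 + \<nu> I2 \<le> \<nu> (I1 - {i1}) + \<nu> (insert i1 I2)) \<or>
        (\<exists>i2 \<in> I2 - I1. \<nu> I1 + \<nu> I2 \<le>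
             \<nu> (insert i2 (I1 - {i1})) + \<nu> (insert i1 (I2 - {i2}))))"

definition qpow_neg :: "real \<Rightarrow> ereal \<Rightarrow> real" where
  "qpow_neg q v = (case v of ereal x \<Rightarrow> q powr (- x) | _ \<Rightarrow> 0)"

definition I_qnu :: "'a set \<Rightarrow> real \<Rightarrow> ('a set \<Rightarrow> ereal) \<Rightarrow> nat \<Rightarrow> real" where
  "I_qnu E q \<nu> k = (\<Sum>I\<in>{I. I \<subseteq> E \<and> card I = k}. qpow_neg q (\<nu> I))"

end

theory Submission
  imports Defs "HOL-Library.Multiset"
begin

text \<open>With \<open>c I = q powr (- \<nu> I)\<close> and \<open>n = card E\<close>, consider the homogeneous polynomial
  \<open>f = (\<Sum>I. c I * x\<^sub>0\<^bsup>n - card I\<^esup> * (\<Prod>i\<in>I. x\<^sub>i))\<close>. Every partial derivative of \<open>f\<close> of degree at least two has,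
  at the all-ones point, a Hessian with at most one positive eigenvalue. By Euler's relation the Hessian
  of a polynomial is a combination of the Hessians of its first derivatives; if these are hyperbolic,
  then after normalizing the row sums to \<open>1\<close> the Hessian becomes a reversible Markov kernel without
  eigenvalues in the open interval from \<open>0\<close> to \<open>1\<close>, and connectivity, a consequence of the exchange property, makes the
  eigenvalue \<open>1\<close> simple. This reduces the claim to quadratic derivatives. There the exchange property says that
  the suitably scaled coefficients \<open>c {i, j}\<close> form an ultrametric, whose form is bounded by
  \<open>(1 - 1/m) * (\<Sum>y)\<^sup>2\<close> on \<open>m\<close> points. Finally, the reversed Cauchy--Schwarz inequality for the
  \<open>(n-k-1)\<close>-st derivative in \<open>x\<^sub>0\<close>, in the limit of small \<open>x\<^sub>0\<close>, is the asserted inequality.\<close>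

section \<open>Ultrametric forms and the reversed Cauchy--Schwarz inequality\<close>

text \<open>The difference of the two sides is a perfect square over a positive number. This
  inequality merges two blocks of \<open>p\<close> and \<open>q\<close> points whose sums are
  \<open>s\<close> and \<open>t\<close>.\<close>

lemma weighted_square_split:
  fixes p q s t :: real
  assumes "p > 0" "q > 0"
  shows "(1 - 1/p) * s\<^sup>2 + (1 - 1/q) * t\<^sup>2 + 2 * (s * t) \<le> (1 - 1/(p+q)) * (s + t)\<^sup>2"
proof -
  have "(1 - 1/(p+q)) * (s + t)\<^sup>2 - ((1 - 1/p) * s\<^sup>2 + (1 - 1/q) * t\<^sup>2 + 2 * (s * t))
      = (q * s - p * t)\<^sup>2 / (p * q * (p + q))"
    using assms by (simp add: field_simps power2_eq_square)
  also have "\<dots> \<ge> 0" using assms by simp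
  finally show ?thesis by simp
qed

lemma double_sum_Un:
  fixes f :: "'a \<Rightarrow> 'a \<Rightarrow> real"
  assumes "finite A" "finite B" "A \<inter> B = {}" "\<And>i j. i \<in> A \<Longrightarrow> j \<in> B \<Longrightarrow> f j i = f i j"
  shows "(\<Sum>i\<in>A \<union> B. \<Sum>j\<in>A \<union> B. f i j) =
    (\<Sum>i\<in>A. \<Sum>j\<in>A. f i j) + (\<Sum>i\<in>B. \<Sum>j\<in>B. f i j) + 2 * (\<Sum>i\<in>A. \<Sum>j\<in>B. f i j)"
proof -
  have "(\<Sum>i\<in>B. \<Sum>j\<in>A. f i j) = (\<Sum>i\<in>A. \<Sum>j\<in>B. f i j)"
    using assms(4) by (subst sum.swap) (intro sum.cong refl, simp)
  then show ?thesis
    using assms by (simp add: sum.union_disjoint sum.distrib)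
qed

text \<open>Induction on the number of points. The open ball of maximal radius around one of two
  farthest points splits the set into two blocks whose mutual distances are all maximal; the bounds
  for the blocks then merge by \<open>weighted_square_split\<close>.\<close>

lemma ultrametric_form_bound:
  fixes r :: "'a \<Rightarrow> 'a \<Rightarrow> real" and y :: "'a \<Rightarrow> real"
  assumes "finite T" "T \<noteq> {}"
    and sym: "\<And>i j. i \<in> T \<Longrightarrow> j \<in> T \<Longrightarrow> r i j = r j i"
    and diag: "\<And>i. i \<in> T \<Longrightarrow> r i i = 0"
    and nonneg: "\<And>i j. i \<in> T \<Longrightarrow> j \<in> T \<Longrightarrow> 0 \<le> r i j"
    and bound: "\<And>i j. i \<in> T \<Longrightarrow> j \<in> T \<Longrightarrow> r i j \<le> R"
    and ultra: "\<And>i j k. i \<in> T \<Longrightarrow> j \<in> T \<Longrightarrow> k \<in> T \<Longrightarrow> r i j \<le> max (r i k) (r k j)"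
  shows "(\<Sum>i\<in>T. \<Sum>j\<in>T. r i j * y i * y j) \<le> R * (1 - 1 / card T) * (\<Sum>i\<in>T. y i)\<^sup>2"
  using assms
proof (induction "card T" arbitrary: T R rule: less_induct)
  case less
  have c1: "1 \<le> real (card T)"
    using less.prems(1,2) by (simp add: card_gt_0_iff Suc_le_eq)
  define S where "S = (\<lambda>p. r (fst p) (snd p)) ` (T \<times> T)"
  have finS: "finite S" "S \<noteq> {}" using less.prems(1,2) by (auto simp: S_def)
  define \<mu> where "\<mu> = Max S"
  have "\<mu> \<in> S" unfolding \<mu>_def using finS by (rule Max_in)
  then obtain p q where pq: "p \<in> T" "q \<in> T" "r p q = \<mu>" by (auto simp: S_def)
  have le: "r i j \<le> \<mu>" if "i \<in> T" "j \<in> T" for i j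
    unfolding \<mu>_def using finS that by (intro Max_ge) (force simp: S_def)+
  have \<mu>R: "\<mu> \<le> R" using pq less.prems(6) by blast
  \<comment> \<open>The bound is proved with the attained maximum \<open>\<mu>\<close>, because the
    distances across the split equal exactly \<open>\<mu>\<close>; the given \<open>R\<close> enters
    only at the end.\<close>
  have "(\<Sum>i\<in>T. \<Sum>j\<in>T. r i j * y i * y j) \<le> \<mu> * (1 - 1 / card T) * (\<Sum>i\<in>T. y i)\<^sup>2"
  proof (cases "\<mu> = 0")
    case True
    then have "r i j = 0" if "i \<in> T" "j \<in> T" for i j
      using le[OF that] less.prems(5)[OF that] by simp
    then show ?thesis using True by simp
  next
    case False
    define A where "A = {i \<in> T. r p i < \<mu>}"
    define B where "B = T - A"
    have mu0: "\<mu> > 0" using False pq less.prems(5)[of p q] by simp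
    have AB: "A \<union> B = T" "A \<inter> B = {}" "finite A" "finite B" "p \<in> A" "q \<in> B"
      using pq less.prems(1,4) mu0 by (auto simp: A_def B_def)
    have cards: "card A < card T" "card B < card T"
      using AB less.prems(1) by (auto intro!: psubset_card_mono)
    have cT: "card T = card A + card B"
      using AB by (metis card_Un_disjoint)
    have pos: "card A > 0" "card B > 0" using AB by (auto simp: card_gt_0_iff)
    have sub: "A \<subseteq> T" "B \<subseteq> T" using AB by auto
    \<comment> \<open>Isosceles property: \<open>r p j = \<mu>\<close> exceeds \<open>r p i\<close>,
      so \<open>r i j\<close> has to be as large as \<open>r p j\<close>.\<close>
    have cross: "r i j = \<mu>" if "i \<in> A" "j \<in> B" for i j
    proof -
      have ij: "i \<in> T" "j \<in> T" using that sub by auto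
      have "r p j = \<mu>" using that le[OF pq(1) ij(2)] by (auto simp: A_def B_def)
      moreover have "r p i < \<mu>" using that by (auto simp: A_def)
      ultimately have "\<mu> \<le> r i j" using less.prems(7)[OF pq(1) ij(2) ij(1)] by linarith
      with le[OF ij] show ?thesis by simp
    qed
    have IHA: "(\<Sum>i\<in>A. \<Sum>j\<in>A. r i j * y i * y j) \<le> \<mu> * (1 - 1 / card A) * (\<Sum>i\<in>A. y i)\<^sup>2"
      using less.prems sub AB le by (intro less.hyps cards) (auto simp: subset_iff)
    have IHB: "(\<Sum>i\<in>B. \<Sum>j\<in>B. r i j * y i * y j) \<le> \<mu> * (1 - 1 / card B) * (\<Sum>i\<in>B. y i)\<^sup>2"
      using less.prems sub AB le by (intro less.hyps cards) (auto simp: subset_iff)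
    have "(\<Sum>i\<in>A. \<Sum>j\<in>B. r i j * y i * y j) = (\<Sum>i\<in>A. \<Sum>j\<in>B. \<mu> * (y i * y j))"
      by (intro sum.cong refl) (simp add: cross)
    then have X: "(\<Sum>i\<in>A. \<Sum>j\<in>B. r i j * y i * y j) = \<mu> * ((\<Sum>i\<in>A. y i) * (\<Sum>j\<in>B. y j))"
      by (simp only: sum_distrib_left[symmetric] sum_distrib_right[symmetric])
    have "(\<Sum>i\<in>T. \<Sum>j\<in>T. r i j * y i * y j) =
       (\<Sum>i\<in>A. \<Sum>j\<in>A. r i j * y i * y j) + (\<Sum>i\<in>B. \<Sum>j\<in>B. r i j * y i * y j)
       + 2 * (\<Sum>i\<in>A. \<Sum>j\<in>B. r i j * y i * y j)"
      unfolding AB(1)[symmetric] using AB sub less.prems(3)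
      by (intro double_sum_Un) (auto simp: subset_iff)
    also have "\<dots> \<le> \<mu> * ((1 - 1 / card A) * (\<Sum>i\<in>A. y i)\<^sup>2 + (1 - 1 / card B) * (\<Sum>i\<in>B. y i)\<^sup>2
        + 2 * ((\<Sum>i\<in>A. y i) * (\<Sum>j\<in>B. y j)))"
      using IHA IHB unfolding X by (simp add: algebra_simps)
    also have "\<dots> \<le> \<mu> * ((1 - 1 / (real (card A) + real (card B))) * ((\<Sum>i\<in>A. y i) + (\<Sum>j\<in>B. y j))\<^sup>2)"
      using mu0 pos by (intro mult_left_mono weighted_square_split) auto
    also have "(\<Sum>i\<in>A. y i) + (\<Sum>j\<in>B. y j) = (\<Sum>i\<in>T. y i)"
      using AB by (metis sum.union_disjoint)
    finally show ?thesis by (simp add: cT mult.assoc)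
  qed
  also have "\<dots> \<le> R * (1 - 1 / card T) * (\<Sum>i\<in>T. y i)\<^sup>2"
    using \<mu>R c1 by (intro mult_right_mono) auto
  finally show ?case .
qed

text \<open>The form is nonpositive on the kernel of \<open>l\<close>. Subtracting from
  \<open>x\<close> the multiple of \<open>y\<close> with the same value of \<open>l\<close> gives a
  vector of that kernel, and completing the square finishes the proof.\<close>

lemma reverse_Cauchy_Schwarz:
  fixes H :: "'v \<Rightarrow> 'v \<Rightarrow> real"
  assumes "finite V" and sym: "\<And>u v. u \<in> V \<Longrightarrow> v \<in> V \<Longrightarrow> H u v = H v u"
    and neg: "\<And>x. (\<Sum>u\<in>V. l u * x u) = 0 \<Longrightarrow> (\<Sum>u\<in>V. \<Sum>v\<in>V. H u v * x u * x v) \<le> 0"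
    and y: "(\<Sum>u\<in>V. \<Sum>v\<in>V. H u v * y u * y v) \<ge> 0"
  shows "(\<Sum>u\<in>V. \<Sum>v\<in>V. H u v * x u * x v) * (\<Sum>u\<in>V. \<Sum>v\<in>V. H u v * y u * y v)
     \<le> (\<Sum>u\<in>V. \<Sum>v\<in>V. H u v * x u * y v)\<^sup>2"
proof -
  define B where "B x y = (\<Sum>u\<in>V. \<Sum>v\<in>V. H u v * x u * y v)" for x y
  have Bsym: "B x y = B y x" for x y
    unfolding B_def by (subst sum.swap) (intro sum.cong refl, simp add: sym algebra_simps)
  show ?thesis
  proof (cases "B y y = 0")
    case True
    then show ?thesis by (simp add: B_def)
  next
    case False
    then have pos: "B y y > 0" using y by (simp add: B_def)
    define ly where "ly = (\<Sum>u\<in>V. l u * y u)"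
    \<comment> \<open>A vector with positive value of the form lies outside the kernel of
      \<open>l\<close>, so \<open>ly\<close> may be divided by.\<close>
    have ly: "ly \<noteq> 0" using neg[of y] pos by (auto simp: ly_def B_def)
    define t where "t = (\<Sum>u\<in>V. l u * x u) / ly"
    define z where "z u = x u - t * y u" for u
    have "(\<Sum>u\<in>V. l u * z u) = (\<Sum>u\<in>V. l u * x u) - t * ly"
      by (simp add: z_def ly_def algebra_simps sum_subtractf sum_distrib_left)
    also have "\<dots> = 0" using ly by (simp add: t_def)
    finally have "B z z \<le> 0" using neg[of z] by (simp add: B_def)
    moreover have "B z z = B x x - t * B x y - t * B y x + t\<^sup>2 * B y y"
      by (simp add: B_def z_def algebra_simps sum_subtractf sum.distrib sum_distrib_left power2_eq_square)
    ultimately have le: "B x x - 2 * t * B x y + t\<^sup>2 * B y y \<le> 0" using Bsym[of x y] by simp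
    have "B x x * B y y \<le> (2 * t * B x y - t\<^sup>2 * B y y) * B y y"
      using le pos by (intro mult_right_mono) auto
    also have "\<dots> = (B x y)\<^sup>2 - (B x y - t * B y y)\<^sup>2"
      by (simp add: power2_eq_square algebra_simps)
    also have "\<dots> \<le> (B x y)\<^sup>2" by simp
    finally show ?thesis by (simp add: B_def)
  qed
qed

section \<open>A spectral gap criterion\<close>

text \<open>Vectors are functions on the whole type, so the coordinates outside \<open>W\<close> are
  pinned to 0; the set is then a closed subset of a product of compact intervals.\<close>

lemma compact_Rayleigh_sphere:
  fixes D :: "'v \<Rightarrow> real"
  assumes "finite W" and D: "\<And>u. u \<in> W \<Longrightarrow> D u > 0"
  shows "compact {x. (\<forall>u. u \<notin> W \<longrightarrow> x u = 0) \<and> (\<Sum>u\<in>W. D u * (x u)\<^sup>2) = 1 \<and> (\<Sum>u\<in>W. D u * x u) = 0}"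
    (is "compact ?C")
proof -
  \<comment> \<open>The sharp bound for a coordinate is \<open>1 / sqrt (D u)\<close>;
    \<open>1 + 1 / D u\<close> is a cruder bound without a root.\<close>
  define K where "K u = (if u \<in> W then {- (1 + 1 / D u) .. 1 + 1 / D u} else {0})" for u
  have "compactin (product_topology (\<lambda>_. euclidean) UNIV) (PiE UNIV K)"
    by (subst compactin_PiE) (auto simp: K_def)
  then have "compact (PiE UNIV K)"
    by (simp add: euclidean_product_topology)
  moreover have "closed {x :: 'v \<Rightarrow> real. (\<Sum>u\<in>W. D u * (x u)\<^sup>2) = 1 \<and> (\<Sum>u\<in>W. D u * x u) = 0}"
    by (intro closed_Collect_conj closed_Collect_eq continuous_intros continuous_on_product_coordinates)
  moreover have "?C = PiE UNIV K \<inter> {x. (\<Sum>u\<in>W. D u * (x u)\<^sup>2) = 1 \<and> (\<Sum>u\<in>W. D u * x u) = 0}"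
  proof -
    have "\<bar>x u\<bar> \<le> 1 + 1 / D u" if x: "(\<Sum>u\<in>W. D u * (x u)\<^sup>2) = 1" and u: "u \<in> W" for x u
    proof -
      have "D u * (x u)\<^sup>2 \<le> (\<Sum>u\<in>W. D u * (x u)\<^sup>2)"
        using assms u by (intro member_le_sum) (auto intro!: mult_nonneg_nonneg[OF less_imp_le[OF D]])
      then have le: "(x u)\<^sup>2 \<le> 1 / D u" using x D[OF u] by (simp add: field_simps)
      have nn: "1 / D u \<ge> 0" using D[OF u] by simp
      have "d \<le> (1 + d)\<^sup>2" if "d \<ge> 0" for d :: real
        using that by (simp add: power2_eq_square algebra_simps)
      from order_trans[OF le this[OF nn]] have "\<bar>x u\<bar>\<^sup>2 \<le> (1 + 1 / D u)\<^sup>2"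
        by simp
      then show ?thesis
        by (rule power2_le_imp_le) (use nn in simp)
    qed
    then show ?thesis by (force simp: K_def PiE_def Pi_def abs_le_iff)
  qed
  ultimately show ?thesis by (simp add: compact_Int_closed)
qed

text \<open>First-order condition at a minimum: for small \<open>t\<close> the linear term
  dominates. If \<open>a\<close> were nonzero, \<open>t = - a / k\<close> with \<open>k > 0\<close>
  and \<open>k > b\<close> would already give a negative value.\<close>

lemma quadratic_nonneg_linear_zero:
  fixes a b :: real
  assumes "\<And>t. 0 \<le> 2 * t * a + t\<^sup>2 * b"
  shows "a = 0"
proof (rule ccontr)
  assume a: "a \<noteq> 0"
  define k where "k = \<bar>b\<bar> + 1"
  have k: "k > 0" "b < k" by (simp_all add: k_def)
  have "0 \<le> 2 * (- a / k) * a + (- a / k)\<^sup>2 * b" by (rule assms)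
  also have "\<dots> = (a\<^sup>2 / k\<^sup>2) * (b - 2 * k)"
    using k by (simp add: field_simps power2_eq_square)
  also have "\<dots> < 0"
    using a k by (intro mult_pos_neg) auto
  finally show False by simp
qed

text \<open>Discrete maximum principle: \<open>x\<close> at a maximum point is at most a weighted
  average of its neighbours, so they attain the maximum too. By connectivity \<open>x\<close> is
  constant on \<open>W\<close>, and orthogonality makes the constant zero.\<close>

lemma eigenvector_maximum_principle:
  fixes H :: "'v \<Rightarrow> 'v \<Rightarrow> real"
  assumes fin: "finite W"
    and nonneg: "\<And>u v. u \<in> W \<Longrightarrow> v \<in> W \<Longrightarrow> 0 \<le> H u v"
    and D: "\<And>u. u \<in> W \<Longrightarrow> (\<Sum>v\<in>W. H u v) > 0"
    and conn: "\<And>u v. u \<in> W \<Longrightarrow> v \<in> W \<Longrightarrow> (u, v) \<in> {(a, b). a \<in> W \<and> b \<in> W \<and> H a b > 0}\<^sup>*"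
    and eig: "\<And>u. u \<in> W \<Longrightarrow> (\<Sum>v\<in>W. H u v * x v) = \<theta> * (\<Sum>v\<in>W. H u v) * x u"
    and "1 \<le> \<theta>" and orth: "(\<Sum>u\<in>W. (\<Sum>v\<in>W. H u v) * x u) = 0"
    and "u \<in> W"
  shows "x u = 0"
proof -
  define \<mu> where "\<mu> = Max (x ` W)"
  have "\<mu> \<in> x ` W" unfolding \<mu>_def using fin \<open>u \<in> W\<close> by (intro Max_in) auto
  then obtain m where m: "m \<in> W" "x m = \<mu>" by auto
  have le: "x v \<le> \<mu>" if "v \<in> W" for v
    unfolding \<mu>_def using fin that by simp
  have mu0: "0 \<le> \<mu>"
  proof (rule ccontr)
    assume "\<not> 0 \<le> \<mu>"
    then have "(\<Sum>u\<in>W. (\<Sum>v\<in>W. H u v) * x u) < (\<Sum>u\<in>W. 0)"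
    proof (intro sum_strict_mono fin)
      show "(\<Sum>v\<in>W. H u v) * x u < 0" if "u \<in> W" for u
        using D[OF that] le[OF that] \<open>\<not> 0 \<le> \<mu>\<close> by (intro mult_pos_neg) auto
    qed (use m in auto)
    then show False using orth by simp
  qed
  have step: "x b = \<mu>" if a: "a \<in> W" and b: "b \<in> W" and ab: "H a b > 0" "x a = \<mu>" for a b
  proof (rule ccontr)
    assume "x b \<noteq> \<mu>"
    then have "x b < \<mu>" using le[OF b] by simp
    then have "(\<Sum>v\<in>W. H a v * x v) < (\<Sum>v\<in>W. H a v * \<mu>)"
      using fin a b ab le nonneg by (intro sum_strict_mono_ex1) (auto intro!: mult_left_mono bexI[of _ b])
    also have "\<dots> = 1 * (\<Sum>v\<in>W. H a v) * \<mu>" by (simp add: sum_distrib_right)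
    \<comment> \<open>Replacing the factor 1 by \<open>\<theta>\<close> is an increase because the
      maximum is nonnegative.\<close>
    also have "\<dots> \<le> \<theta> * (\<Sum>v\<in>W. H a v) * \<mu>"
      using \<open>1 \<le> \<theta>\<close> D[OF a] mu0 by (intro mult_right_mono) auto
    finally show False using eig[OF a] ab by simp
  qed
  have all: "x v = \<mu>" if "v \<in> W" for v
    using conn[OF m(1) that] by (induction rule: rtrancl_induct) (use m step in auto)
  have "(\<Sum>u\<in>W. (\<Sum>v\<in>W. H u v)) * \<mu> = 0"
    using orth by (simp add: all sum_distrib_right)
  moreover have "(\<Sum>u\<in>W. (\<Sum>v\<in>W. H u v)) > 0"
    using m by (intro sum_pos fin D) auto
  ultimately show ?thesis using all[OF \<open>u \<in> W\<close>] by simp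
qed

text \<open>For the reversible Markov kernel \<open>P = D\<^sup>-\<^sup>1 H\<close> the hypothesis \<open>gap\<close> reads \<open>P \<le> P\<^sup>2\<close>, so that
  every eigenvalue of \<open>P\<close> is either at most \<open>0\<close> or at least \<open>1\<close>; by connectivity the eigenvalue \<open>1\<close> is simple.\<close>

lemma connected_form_nonpos_on_orthogonal:
  fixes H :: "'v \<Rightarrow> 'v \<Rightarrow> real"
  defines "D \<equiv> \<lambda>W u. \<Sum>v\<in>W. H u v"
  assumes fin: "finite W"
    and sym: "\<And>u v. u \<in> W \<Longrightarrow> v \<in> W \<Longrightarrow> H u v = H v u"
    and nonneg: "\<And>u v. u \<in> W \<Longrightarrow> v \<in> W \<Longrightarrow> 0 \<le> H u v"
    and Dpos: "\<And>u. u \<in> W \<Longrightarrow> D W u > 0"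
    and conn: "\<And>u v. u \<in> W \<Longrightarrow> v \<in> W \<Longrightarrow> (u, v) \<in> {(a, b). a \<in> W \<and> b \<in> W \<and> H a b > 0}\<^sup>*"
    and gap: "\<And>x. (\<Sum>u\<in>W. \<Sum>v\<in>W. H u v * x u * x v) \<le> (\<Sum>u\<in>W. (\<Sum>v\<in>W. H u v * x v)\<^sup>2 / D W u)"
    and orth: "(\<Sum>u\<in>W. D W u * x u) = 0"
  shows "(\<Sum>u\<in>W. \<Sum>v\<in>W. H u v * x u * x v) \<le> 0"
proof (rule ccontr)
  define B where "B x y = (\<Sum>u\<in>W. \<Sum>v\<in>W. H u v * x u * y v)" for x y
  define N where "N x y = (\<Sum>u\<in>W. D W u * x u * y u)" for x y
  define L where "L x = (\<Sum>u\<in>W. D W u * x u)" for x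
  have Bsym: "B x y = B y x" for x y
    unfolding B_def by (subst sum.swap) (intro sum.cong refl, simp add: sym algebra_simps)
  have Nsym: "N x y = N y x" for x y
    unfolding N_def by (simp add: algebra_simps)
  have Bscale: "B (\<lambda>u. r * x u) (\<lambda>u. r * x u) = r\<^sup>2 * B x x" for r x
    by (simp add: B_def sum_distrib_left power2_eq_square algebra_simps)
  have Nscale: "N (\<lambda>u. r * x u) (\<lambda>u. r * x u) = r\<^sup>2 * N x x" for r x
    by (simp add: N_def sum_distrib_left power2_eq_square algebra_simps)
  have Lscale: "L (\<lambda>u. r * x u) = r * L x" for r x
    by (simp add: L_def sum_distrib_left algebra_simps)
  define C where "C = {x. (\<forall>u. u \<notin> W \<longrightarrow> x u = 0) \<and> (\<Sum>u\<in>W. D W u * (x u)\<^sup>2) = 1 \<and> (\<Sum>u\<in>W. D W u * x u) = 0}"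
  have C_iff: "x \<in> C \<longleftrightarrow> (\<forall>u. u \<notin> W \<longrightarrow> x u = 0) \<and> N x x = 1 \<and> L x = 0" for x
    by (simp add: C_def N_def L_def power2_eq_square mult.assoc)
  have compC: "compact C"
    unfolding C_def by (rule compact_Rayleigh_sphere[OF fin Dpos])
  have N0: "N x x \<ge> 0" for x
    unfolding N_def using Dpos by (intro sum_nonneg) (simp add: mult.assoc less_imp_le)
  have N_zero: "B x y = 0" if "N x x = 0" for x y
  proof -
    have "\<forall>u\<in>W. D W u * x u * x u = 0"
      using that fin Dpos unfolding N_def
      by (subst (asm) sum_nonneg_eq_0_iff) (auto simp: mult.assoc less_imp_le)
    then have "\<forall>u\<in>W. x u = 0" using Dpos by force
    then show ?thesis by (simp add: B_def)
  qed
  define nz where "nz x = (\<lambda>u. (1 / sqrt (N x x)) * (if u \<in> W then x u else 0))" for x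
  have nzC: "nz x \<in> C" and Bnz: "B (nz x) (nz x) = B x x / N x x"
    if "N x x > 0" "L x = 0" for x
  proof -
    let ?x = "\<lambda>u. if u \<in> W then x u else 0"
    have e: "N ?x ?x = N x x" "L ?x = L x" "B ?x ?x = B x x" by (simp_all add: N_def L_def B_def)
    have s: "(1 / sqrt (N x x))\<^sup>2 = 1 / N x x" using that by (simp add: power_divide)
    show "nz x \<in> C" "B (nz x) (nz x) = B x x / N x x"
      unfolding C_iff nz_def Nscale Lscale Bscale e s using that by auto
  qed
  assume "\<not> (\<Sum>u\<in>W. \<Sum>v\<in>W. H u v * x u * x v) \<le> 0"
  then have Bx: "B x x > 0" by (simp add: B_def)
  then have Nx: "N x x > 0" using N_zero[of x x] N0[of x] by linarith
  have Lx: "L x = 0" using orth by (simp add: L_def)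
  have "continuous_on C (\<lambda>x. B x x)"
    unfolding B_def
    by (intro continuous_intros continuous_on_subset[OF continuous_on_product_coordinates subset_UNIV])
  \<comment> \<open>\<open>z\<close> maximizes the Rayleigh quotient of \<open>B\<close> and
    \<open>N\<close> on the hyperplane orthogonal to the constants. The supposed counterexample
    \<open>x\<close> makes the maximum \<open>\<theta>\<close> positive.\<close>
  then obtain z where z: "z \<in> C" and zmax: "\<And>y. y \<in> C \<Longrightarrow> B y y \<le> B z z"
    using continuous_attains_sup[OF compC] nzC[OF Nx Lx] by blast
  define \<theta> where "\<theta> = B z z"
  have Nz: "N z z = 1" and Lz: "L z = 0" using z by (auto simp: C_iff)
  have lam: "\<theta> > 0"
    using zmax[OF nzC[OF Nx Lx]] Bnz[OF Nx Lx] Bx Nx unfolding \<theta>_def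
    by (smt (verit) divide_pos_pos)
  have max: "B y y \<le> \<theta> * N y y" if "L y = 0" for y
  proof (cases "N y y = 0")
    case True then show ?thesis using N_zero by simp
  next
    case False
    then have Ny: "N y y > 0" using N0[of y] by simp
    from zmax[OF nzC[OF Ny that]] show ?thesis
      unfolding Bnz[OF Ny that] \<theta>_def using Ny by (simp add: field_simps)
  qed
  \<comment> \<open>First variation: \<open>\<theta> * N y y - B y y\<close> is nonnegative on the
    hyperplane and vanishes at \<open>z\<close>, so its linear term vanishes in every direction of
    the hyperplane.\<close>
  have first: "B z y = \<theta> * N z y" if "L y = 0" for y
  proof -
    have "\<theta> * N z y - B z y = 0"
    proof (rule quadratic_nonneg_linear_zero)
      fix t
      let ?w = "\<lambda>u. z u + t * y u"
      have "L ?w = L z + t * L y"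
        by (simp add: L_def algebra_simps sum.distrib sum_distrib_left)
      then have "B ?w ?w \<le> \<theta> * N ?w ?w" using max Lz that by simp
      moreover have "B ?w ?w = B z z + t * B z y + t * B y z + t\<^sup>2 * B y y"
        by (simp add: B_def algebra_simps sum.distrib sum_distrib_left power2_eq_square)
      moreover have "N ?w ?w = N z z + t * N z y + t * N y z + t\<^sup>2 * N y y"
        by (simp add: N_def algebra_simps sum.distrib sum_distrib_left power2_eq_square)
      ultimately show "0 \<le> 2 * t * (\<theta> * N z y - B z y) + t\<^sup>2 * (\<theta> * N y y - B y y)"
        using Bsym[of y z] Nsym[of y z] Nz unfolding \<theta>_def[symmetric] by (simp add: algebra_simps)
    qed
    then show ?thesis by simp
  qed
  define Hz where "Hz u = (\<Sum>v\<in>W. H u v * z v)" for u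
  \<comment> \<open>\<open>e\<close> is the residual of the eigenvalue equation. It satisfies
    \<open>L e = 0\<close>, so it may be inserted into \<open>first\<close>, which then says that
    its weighted square norm is zero.\<close>
  define e where "e u = Hz u / D W u - \<theta> * z u" for u
  have DHz: "D W u * e u = Hz u - \<theta> * D W u * z u" if "u \<in> W" for u
    using Dpos[OF that] by (simp add: e_def field_simps)
  have "(\<Sum>u\<in>W. Hz u) = L z"
  proof -
    have "(\<Sum>u\<in>W. Hz u) = (\<Sum>v\<in>W. \<Sum>u\<in>W. H v u * z v)"
      unfolding Hz_def by (subst sum.swap) (intro sum.cong refl, simp add: sym)
    then show ?thesis by (simp add: L_def D_def sum_distrib_right)
  qed
  then have "L e = 0"
    using Lz by (simp add: L_def DHz sum_subtractf mult.assoc flip: sum_distrib_left)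
  from first[OF this] have "B z e - \<theta> * N z e = 0" by simp
  moreover have "B z e = (\<Sum>u\<in>W. Hz u * e u)"
    unfolding Bsym[of z e] unfolding B_def Hz_def by (simp add: sum_distrib_left sum_distrib_right mult_ac)
  moreover have "\<theta> * N z e = (\<Sum>u\<in>W. (\<theta> * D W u * z u) * e u)"
    by (simp add: N_def sum_distrib_left mult_ac)
  ultimately have "(\<Sum>u\<in>W. D W u * e u * e u) = 0"
    by (simp add: DHz left_diff_distrib sum_subtractf)
  then have "\<forall>u\<in>W. D W u * e u * e u = 0"
    using fin Dpos by (subst (asm) sum_nonneg_eq_0_iff) (auto simp: mult.assoc less_imp_le)
  then have "\<forall>u\<in>W. e u = 0" using Dpos by force
  then have eig: "Hz u = \<theta> * D W u * z u" if "u \<in> W" for u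
    using DHz[OF that] that by simp
  \<comment> \<open>At the eigenvector \<open>z\<close>, the hypothesis \<open>gap\<close> reads
    \<open>\<theta> \<le> \<theta>\<^sup>2\<close>, which forces
    \<open>1 \<le> \<theta>\<close>.\<close>
  have "\<theta> \<le> (\<Sum>u\<in>W. (Hz u)\<^sup>2 / D W u)"
    using gap[of z] by (simp add: \<theta>_def B_def Hz_def)
  also have "\<dots> = (\<Sum>u\<in>W. \<theta>\<^sup>2 * (D W u * z u * z u))"
    using Dpos by (intro sum.cong refl) (force simp: eig field_simps power2_eq_square)
  also have "\<dots> = \<theta>\<^sup>2" using Nz by (simp add: N_def flip: sum_distrib_left)
  finally have "1 \<le> \<theta>" using lam by (simp add: power2_eq_square)
  then have "z u = 0" if "u \<in> W" for u
    using eigenvector_maximum_principle[of W H z \<theta> u] fin nonneg Dpos conn eig Lz that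
    unfolding D_def Hz_def L_def by blast
  then have "N z z = 0" by (simp add: N_def)
  with Nz show False by simp
qed

section \<open>From local to global hyperbolicity\<close>

text \<open>\<open>hyperbolic_at_one V H\<close>: the quadratic form of \<open>H\<close> satisfies the reversed Cauchy--Schwarz inequality
  \<open>Q(x) Q(1) \<le> B(x, 1)\<^sup>2\<close> at the all-ones vector.\<close>

definition hyperbolic_at_one :: "'v set \<Rightarrow> ('v \<Rightarrow> 'v \<Rightarrow> real) \<Rightarrow> bool" where
  "hyperbolic_at_one V H \<longleftrightarrow> (\<forall>x. (\<Sum>u\<in>V. \<Sum>v\<in>V. H u v * x u * x v) * (\<Sum>u\<in>V. \<Sum>v\<in>V. H u v)
     \<le> (\<Sum>u\<in>V. (\<Sum>v\<in>V. H u v) * x u)\<^sup>2)"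

lemma hyperbolic_at_oneI:
  assumes fin: "finite V" and sym: "\<And>u v. u \<in> V \<Longrightarrow> v \<in> V \<Longrightarrow> H u v = H v u"
    and nonneg: "\<And>u v. u \<in> V \<Longrightarrow> v \<in> V \<Longrightarrow> 0 \<le> H u v"
    and neg: "\<And>x. (\<Sum>u\<in>V. l u * x u) = 0 \<Longrightarrow> (\<Sum>u\<in>V. \<Sum>v\<in>V. H u v * x u * x v) \<le> 0"
  shows "hyperbolic_at_one V H"
  unfolding hyperbolic_at_one_def
proof
  fix x :: "'a \<Rightarrow> real"
  have "0 \<le> (\<Sum>u\<in>V. \<Sum>v\<in>V. H u v * 1 * 1)"
    using nonneg by (auto intro!: sum_nonneg)
  from reverse_Cauchy_Schwarz[of V H l "\<lambda>_. 1" x, OF fin sym neg this]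
  show "(\<Sum>u\<in>V. \<Sum>v\<in>V. H u v * x u * x v) * (\<Sum>u\<in>V. \<Sum>v\<in>V. H u v)
     \<le> (\<Sum>u\<in>V. (\<Sum>v\<in>V. H u v) * x u)\<^sup>2"
    by (simp add: sum_distrib_right)
qed

lemma hyperbolic_at_one_scale:
  assumes "hyperbolic_at_one V (\<lambda>u v. c * H u v)" "c \<noteq> 0"
  shows "hyperbolic_at_one V H"
  unfolding hyperbolic_at_one_def
proof
  fix x :: "'a \<Rightarrow> real"
  have "(\<Sum>u\<in>V. \<Sum>v\<in>V. c * H u v * x u * x v) * (\<Sum>u\<in>V. \<Sum>v\<in>V. c * H u v)
     \<le> (\<Sum>u\<in>V. (\<Sum>v\<in>V. c * H u v) * x u)\<^sup>2"
    using assms by (simp add: hyperbolic_at_one_def)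
  then have "(c * c) * ((\<Sum>u\<in>V. \<Sum>v\<in>V. H u v * x u * x v) * (\<Sum>u\<in>V. \<Sum>v\<in>V. H u v))
     \<le> (c * c) * (\<Sum>u\<in>V. (\<Sum>v\<in>V. H u v) * x u)\<^sup>2"
    by (simp add: mult.assoc power_mult_distrib power2_eq_square mult.left_commute flip: sum_distrib_left)
  moreover have "c * c > 0" using assms(2) by (auto simp: zero_less_mult_iff)
  ultimately show "(\<Sum>u\<in>V. \<Sum>v\<in>V. H u v * x u * x v) * (\<Sum>u\<in>V. \<Sum>v\<in>V. H u v)
     \<le> (\<Sum>u\<in>V. (\<Sum>v\<in>V. H u v) * x u)\<^sup>2"
    by (simp only: mult_le_cancel_left_pos)
qed

text \<open>\<open>T w\<close> stands for the Hessian of the derivative in direction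
  \<open>w\<close>. By symmetry its row sums form the row \<open>w\<close> of \<open>H\<close>, so
  dividing the local inequality for \<open>w\<close> by that row's sum and adding over
  \<open>w\<close> yields the hypothesis \<open>gap\<close> of
  \<open>connected_form_nonpos_on_orthogonal\<close>.\<close>

lemma hyperbolic_local_to_global:
  fixes T :: "'v \<Rightarrow> 'v \<Rightarrow> 'v \<Rightarrow> real"
  defines "H \<equiv> \<lambda>V u v. \<Sum>w\<in>V. T w u v"
  assumes fin: "finite V"
    and sym1: "\<And>u v w. T u v w = T v u w" and sym2: "\<And>u v w. T u v w = T u w v"
    and nonneg: "\<And>u v w. 0 \<le> T u v w"
    and hyp: "\<And>w. w \<in> V \<Longrightarrow> hyperbolic_at_one V (T w)"
    and conn: "\<And>u v. u \<in> V \<Longrightarrow> v \<in> V \<Longrightarrow> (\<Sum>w\<in>V. H V u w) > 0 \<Longrightarrow> (\<Sum>w\<in>V. H V v w) > 0 \<Longrightarrow>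
         (u, v) \<in> {(a, b). a \<in> V \<and> b \<in> V \<and> H V a b > 0}\<^sup>*"
  shows "hyperbolic_at_one V (H V)"
proof -
  let ?H = "H V"
  define D where "D u = (\<Sum>v\<in>V. ?H u v)" for u
  have Hsym: "?H u v = ?H v u" for u v unfolding H_def using sym2 by (intro sum.cong refl)
  have H0: "?H u v \<ge> 0" for u v unfolding H_def using nonneg by (intro sum_nonneg)
  have D0: "D u \<ge> 0" for u unfolding D_def using H0 by (intro sum_nonneg)
  have row: "(\<Sum>v\<in>V. T w u v) = ?H w u" for w u
    unfolding H_def using sym1 sym2 by (intro sum.cong refl) metis
  \<comment> \<open>A row with sum zero vanishes identically; discarding these rows makes division
    by the row sums possible.\<close>
  define W where "W = {u \<in> V. D u > 0}"
  have WV: "W \<subseteq> V" "finite W" using fin by (auto simp: W_def)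
  have Hz: "?H u v = 0" if "u \<in> V" "v \<in> V" "u \<notin> W \<or> v \<notin> W" for u v
  proof -
    have "?H a b = 0" if "a \<in> V" "b \<in> V" "a \<notin> W" for a b
    proof -
      have "D a = 0" using that D0[of a] by (auto simp: W_def)
      then have "\<forall>b\<in>V. ?H a b = 0"
        unfolding D_def using fin H0 by (subst (asm) sum_nonneg_eq_0_iff) auto
      then show ?thesis using that by blast
    qed
    then show ?thesis using that Hsym by metis
  qed
  have sumW: "(\<Sum>v\<in>V. ?H u v * g v) = (\<Sum>v\<in>W. ?H u v * g v)" if "u \<in> V" for u g
    using WV Hz that by (intro sum.mono_neutral_right fin) auto
  have dsumW: "(\<Sum>u\<in>V. \<Sum>v\<in>V. ?H u v * x u * x v) = (\<Sum>u\<in>W. \<Sum>v\<in>W. ?H u v * x u * x v)" for x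
  proof -
    have "(\<Sum>u\<in>V. \<Sum>v\<in>V. ?H u v * x u * x v) = (\<Sum>u\<in>W. \<Sum>v\<in>V. ?H u v * x u * x v)"
      using WV Hz by (intro sum.mono_neutral_right fin) auto
    also have "\<dots> = (\<Sum>u\<in>W. \<Sum>v\<in>W. ?H u v * x u * x v)"
      using WV Hz by (intro sum.cong sum.mono_neutral_right fin refl) auto
    finally show ?thesis .
  qed
  have DW: "(\<Sum>v\<in>W. ?H u v) = D u" if "u \<in> V" for u
    using sumW[OF that, of "\<lambda>_. 1"] by (simp add: D_def)
  have gap: "(\<Sum>u\<in>W. \<Sum>v\<in>W. ?H u v * x u * x v) \<le> (\<Sum>w\<in>W. (\<Sum>v\<in>W. ?H w v * x v)\<^sup>2 / (\<Sum>v\<in>W. ?H w v))" for x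
  proof -
    define Q where "Q w = (\<Sum>u\<in>V. \<Sum>v\<in>V. T w u v * x u * x v)" for w
    have Q: "Q w * D w \<le> (\<Sum>v\<in>V. ?H w v * x v)\<^sup>2" if "w \<in> V" for w
      using hyp[OF that] unfolding hyperbolic_at_one_def Q_def D_def row by blast
    have Qz: "Q w = 0" if "w \<in> V" "w \<notin> W" for w
    proof -
      have "T w u v = 0" if "u \<in> V" "v \<in> V" for u v
      proof -
        have "(\<Sum>v\<in>V. T w u v) = 0" using Hz \<open>w \<in> V\<close> \<open>w \<notin> W\<close> that row by simp
        then show ?thesis using fin nonneg that by (simp add: sum_nonneg_eq_0_iff)
      qed
      then show ?thesis by (simp add: Q_def)
    qed
    have "(\<Sum>u\<in>V. \<Sum>v\<in>V. ?H u v * x u * x v) = (\<Sum>u\<in>V. \<Sum>v\<in>V. \<Sum>w\<in>V. T w u v * x u * x v)"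
      by (simp add: H_def sum_distrib_right)
    also have "\<dots> = (\<Sum>u\<in>V. \<Sum>w\<in>V. \<Sum>v\<in>V. T w u v * x u * x v)"
      by (intro sum.cong refl sum.swap)
    also have "\<dots> = (\<Sum>w\<in>V. Q w)" unfolding Q_def by (rule sum.swap)
    also have "\<dots> = (\<Sum>w\<in>W. Q w)"
      using WV Qz by (intro sum.mono_neutral_right fin) auto
    also have "\<dots> \<le> (\<Sum>w\<in>W. (\<Sum>v\<in>V. ?H w v * x v)\<^sup>2 / D w)"
      using Q by (intro sum_mono) (auto simp: W_def pos_le_divide_eq)
    also have "\<dots> = (\<Sum>w\<in>W. (\<Sum>v\<in>W. ?H w v * x v)\<^sup>2 / (\<Sum>v\<in>W. ?H w v))"
      using WV by (intro sum.cong refl) (auto simp: sumW DW)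
    finally show ?thesis unfolding dsumW .
  qed
  have connW: "(u, v) \<in> {(a, b). a \<in> W \<and> b \<in> W \<and> ?H a b > 0}\<^sup>*" if "u \<in> W" "v \<in> W" for u v
  proof -
    have "{(a, b). a \<in> V \<and> b \<in> V \<and> ?H a b > 0} = {(a, b). a \<in> W \<and> b \<in> W \<and> ?H a b > 0}"
      using Hz WV(1) by (metis (no_types, lifting) less_irrefl subsetD)
    then show ?thesis using conn[of u v] that by (simp add: W_def D_def)
  qed
  show ?thesis
  proof (rule hyperbolic_at_oneI[where l = D, OF fin Hsym H0])
    fix x assume x: "(\<Sum>u\<in>V. D u * x u) = 0"
    have "(\<Sum>u\<in>V. D u * x u) = (\<Sum>u\<in>W. D u * x u)"
      using WV D0 by (intro sum.mono_neutral_right fin) (auto simp: W_def antisym_conv1 le_less)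
    then have "(\<Sum>u\<in>W. (\<Sum>v\<in>W. ?H u v) * x u) = 0"
      using x WV by (simp add: DW subset_iff)
    moreover have "0 < (\<Sum>v\<in>W. ?H u v)" if "u \<in> W" for u
    proof -
      have "u \<in> V" "D u > 0" using that by (simp_all add: W_def)
      then show ?thesis by (simp add: DW)
    qed
    ultimately show "(\<Sum>u\<in>V. \<Sum>v\<in>V. ?H u v * x u * x v) \<le> 0"
      unfolding dsumW
      by (intro connected_form_nonpos_on_orthogonal[of W ?H x, OF WV(2) Hsym H0 _ connW gap])
  qed
qed

section \<open>Partial derivatives at the all-ones point\<close>

text \<open>Falling factorial, that is, the \<open>k\<close>-th derivative of the
  \<open>m\<close>-th power at 1. It is zero for \<open>k > m\<close> because of the factor with
  \<open>i = m\<close>.\<close>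

definition ffall :: "nat \<Rightarrow> nat \<Rightarrow> real" where
  "ffall m k = (\<Prod>i<k. real m - real i)"

lemma ffall_0 [simp]: "ffall m 0 = 1"
  by (simp add: ffall_def)

lemma ffall_Suc: "ffall m (Suc k) = ffall m k * (real m - real k)"
  by (simp add: ffall_def)

lemma ffall_pos: "k \<le> m \<Longrightarrow> ffall m k > 0"
  by (auto simp: ffall_def intro!: prod_pos)

lemma ffall_eq_0: "m < k \<Longrightarrow> ffall m k = 0"
  by (auto simp: ffall_def)

lemma ffall_nonneg: "ffall m k \<ge> 0"
  by (cases "k \<le> m") (simp_all add: ffall_eq_0 ffall_pos less_imp_le)

lemma ffall_self: "ffall m m = fact m"
proof -
  have "ffall m k * fact (m - k) = fact m" if "k \<le> m" for k
    using that
  proof (induction k)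
    case (Suc k)
    then have "fact (m - k) = (real m - real k) * fact (m - Suc k)"
      by (metis Suc_diff_Suc Suc_le_lessD fact_Suc of_nat_diff less_imp_le)
    then show ?case using Suc by (simp add: ffall_Suc)
  qed simp
  from this[of m] show ?thesis by simp
qed

text \<open>The value at the all-ones point of the partial derivative of order \<open>M\<close> of the polynomial
  \<open>\<Sum>I\<in>A. c I * x\<^bsup>N I\<^esup>\<close> in the variables \<open>V\<close>; monomials are multisets of variables.\<close>

definition deriv_at_one :: "'v set \<Rightarrow> 'i set \<Rightarrow> ('i \<Rightarrow> real) \<Rightarrow> ('i \<Rightarrow> 'v multiset) \<Rightarrow> 'v multiset \<Rightarrow> real" where
  "deriv_at_one V A c N M = (\<Sum>I\<in>A. c I * (\<Prod>v\<in>V. ffall (count (N I) v) (count M v)))"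

lemma sum_count_eq_size:
  assumes "finite V" "set_mset M \<subseteq> V"
  shows "(\<Sum>v\<in>V. count M v) = size M"
  unfolding size_multiset_overloaded_eq using assms
  by (intro sum.mono_neutral_right) (auto simp: not_in_iff)

lemma prod_ffall_add_mset:
  assumes "finite V" "w \<in> V"
  shows "(\<Prod>v\<in>V. ffall (count K v) (count (add_mset w M) v)) =
    (\<Prod>v\<in>V. ffall (count K v) (count M v)) * (real (count K w) - real (count M w))"
proof -
  have "(\<Prod>v\<in>V. ffall (count K v) (count (add_mset w M) v)) =
     ffall (count K w) (Suc (count M w)) * (\<Prod>v\<in>V - {w}. ffall (count K v) (count M v))"
    using assms by (subst prod.remove[of V w]) (auto intro!: prod.cong split: if_splits)
  also have "\<dots> = (\<Prod>v\<in>V. ffall (count K v) (count M v)) * (real (count K w) - real (count M w))"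
    using assms by (simp add: prod.remove[of V w] ffall_Suc)
  finally show ?thesis .
qed

text \<open>Differentiating once more in \<open>w\<close> multiplies the term of \<open>I\<close> by
  \<open>count (N I) w - count M w\<close>; over all variables these differences add up to the
  remaining degree.\<close>

lemma Euler_deriv_at_one:
  assumes "finite V" "set_mset M \<subseteq> V"
    and "\<And>I. I \<in> A \<Longrightarrow> set_mset (N I) \<subseteq> V" "\<And>I. I \<in> A \<Longrightarrow> size (N I) = n"
  shows "(\<Sum>w\<in>V. deriv_at_one V A c N (add_mset w M)) = (real n - real (size M)) * deriv_at_one V A c N M"
proof -
  have "(\<Sum>w\<in>V. deriv_at_one V A c N (add_mset w M)) =
    (\<Sum>I\<in>A. \<Sum>w\<in>V. c I * (\<Prod>v\<in>V. ffall (count (N I) v) (count M v)) * (real (count (N I) w) - real (count M w)))"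
    unfolding deriv_at_one_def using assms(1)
    by (subst sum.swap) (intro sum.cong refl, simp only: prod_ffall_add_mset mult.assoc)
  also have "\<dots> = (\<Sum>I\<in>A. c I * (\<Prod>v\<in>V. ffall (count (N I) v) (count M v)) * (real n - real (size M)))"
    using assms by (intro sum.cong refl)
      (simp add: sum_subtractf sum_count_eq_size flip: sum_distrib_left of_nat_sum)
  finally show ?thesis by (simp add: deriv_at_one_def sum_distrib_left mult_ac)
qed

lemma deriv_at_one_nonneg:
  assumes "\<And>I. I \<in> A \<Longrightarrow> 0 \<le> c I"
  shows "deriv_at_one V A c N M \<ge> 0"
  unfolding deriv_at_one_def using assms by (intro sum_nonneg mult_nonneg_nonneg prod_nonneg) (auto simp: ffall_nonneg)

lemma prod_ffall_pos_iff:
  assumes "finite V" "set_mset M \<subseteq> V"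
  shows "(\<Prod>v\<in>V. ffall (count K v) (count M v)) > 0 \<longleftrightarrow> M \<subseteq># K"
proof
  assume "M \<subseteq># K"
  then show "(\<Prod>v\<in>V. ffall (count K v) (count M v)) > 0"
    by (intro prod_pos ffall_pos) (simp add: subseteq_mset_def)
next
  assume pos: "(\<Prod>v\<in>V. ffall (count K v) (count M v)) > 0"
  have "count M v \<le> count K v" for v
  proof (cases "v \<in> V")
    case True
    then have "ffall (count K v) (count M v) \<noteq> 0"
      using pos prod_zero[OF assms(1), of "\<lambda>v. ffall (count K v) (count M v)"] by force
    then show ?thesis using ffall_eq_0 by (meson not_le)
  next
    case False
    then show ?thesis using assms(2) by (metis not_in_iff subsetD zero_le)
  qed
  then show "M \<subseteq># K" by (simp add: subseteq_mset_def)
qed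

text \<open>Nonnegative coefficients exclude cancellation, so positivity depends only on which
  monomials are present and divisible by \<open>M\<close>.\<close>

lemma deriv_at_one_pos_iff:
  assumes "finite V" "finite A" "set_mset M \<subseteq> V" "\<And>I. I \<in> A \<Longrightarrow> 0 \<le> c I"
  shows "deriv_at_one V A c N M > 0 \<longleftrightarrow> (\<exists>I\<in>A. c I > 0 \<and> M \<subseteq># N I)"
proof -
  let ?p = "\<lambda>I. \<Prod>v\<in>V. ffall (count (N I) v) (count M v)"
  have p0: "?p I \<ge> 0" for I by (intro prod_nonneg) (simp add: ffall_nonneg)
  have nn: "c I * ?p I \<ge> 0" if "I \<in> A" for I using assms(4)[OF that] p0 by simp
  have "deriv_at_one V A c N M > 0 \<longleftrightarrow> deriv_at_one V A c N M \<noteq> 0"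
    using deriv_at_one_nonneg[OF assms(4)] by (auto simp: less_le)
  also have "\<dots> \<longleftrightarrow> (\<exists>I\<in>A. c I * ?p I \<noteq> 0)"
    unfolding deriv_at_one_def using assms(2) nn by (subst sum_nonneg_eq_0_iff) auto
  also have "\<dots> \<longleftrightarrow> (\<exists>I\<in>A. c I > 0 \<and> ?p I > 0)"
    using assms(4) p0 by (intro bex_cong refl) (auto simp only: mult_eq_0_iff less_le)
  finally show ?thesis using prod_ffall_pos_iff[OF assms(1,3)] by simp
qed

text \<open>Induction on the remaining degree \<open>n - size M\<close>. The Hessians one order
  further are hyperbolic by induction, and Euler's relation adds them up to a positive multiple of
  the required one.\<close>

theorem hyperbolic_deriv_induct:
  assumes fin: "finite V" "finite A"
    and N: "\<And>I. I \<in> A \<Longrightarrow> set_mset (N I) \<subseteq> V" "\<And>I. I \<in> A \<Longrightarrow> size (N I) = n"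
    and c: "\<And>I. I \<in> A \<Longrightarrow> 0 \<le> c I"
    and conn: "\<And>M u v. set_mset M \<subseteq> V \<Longrightarrow> size M + 3 \<le> n \<Longrightarrow> u \<in> V \<Longrightarrow> v \<in> V \<Longrightarrow>
      deriv_at_one V A c N (add_mset u M) > 0 \<Longrightarrow> deriv_at_one V A c N (add_mset v M) > 0 \<Longrightarrow>
      (u, v) \<in> {(a, b). a \<in> V \<and> b \<in> V \<and> deriv_at_one V A c N (add_mset a (add_mset b M)) > 0}\<^sup>*"
    and base: "\<And>M. set_mset M \<subseteq> V \<Longrightarrow> size M + 2 = n \<Longrightarrow>
      hyperbolic_at_one V (\<lambda>u v. deriv_at_one V A c N (add_mset u (add_mset v M)))"
    and M: "set_mset M \<subseteq> V" "size M + 2 \<le> n"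
  shows "hyperbolic_at_one V (\<lambda>u v. deriv_at_one V A c N (add_mset u (add_mset v M)))"
  using M
proof (induction "n - size M" arbitrary: M rule: less_induct)
  case less
  let ?G = "deriv_at_one V A c N"
  show ?case
  proof (cases "size M + 2 = n")
    case True
    then show ?thesis using base less.prems by simp
  next
    case False
    then have sz: "size M + 3 \<le> n" using less.prems by simp
    define T where "T w u v = ?G (add_mset u (add_mset v (add_mset w M)))" for w u v
    define d where "d = real n - real (size M) - 2"
    have d: "d > 0" using sz by (simp add: d_def)
    have E: "(\<Sum>w\<in>V. T w u v) = d * ?G (add_mset u (add_mset v M))" if "u \<in> V" "v \<in> V" for u v
    proof -
      have "(\<Sum>w\<in>V. T w u v) = (\<Sum>w\<in>V. ?G (add_mset w (add_mset u (add_mset v M))))"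
        unfolding T_def by (simp add: add_mset_commute)
      also have "\<dots> = d * ?G (add_mset u (add_mset v M))"
        using less.prems that by (subst Euler_deriv_at_one[OF fin(1) _ N]) (auto simp: d_def)
      finally show ?thesis .
    qed
    \<comment> \<open>Euler's relation is applied twice: a row sum is a positive multiple of a first
      derivative, which translates positivity into the form required by \<open>conn\<close>.\<close>
    have row: "(\<Sum>w\<in>V. \<Sum>z\<in>V. T z u w) = d * (d + 1) * ?G (add_mset u M)" if "u \<in> V" for u
    proof -
      have "(\<Sum>w\<in>V. \<Sum>z\<in>V. T z u w) = (\<Sum>w\<in>V. d * ?G (add_mset w (add_mset u M)))"
        using that by (intro sum.cong refl) (simp add: E add_mset_commute)
      also have "\<dots> = d * ((d + 1) * ?G (add_mset u M))"
        unfolding sum_distrib_left[symmetric] using less.prems that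
        by (subst Euler_deriv_at_one[OF fin(1) _ N]) (auto simp: d_def)
      finally show ?thesis by simp
    qed
    have "hyperbolic_at_one V (\<lambda>u v. \<Sum>w\<in>V. T w u v)"
    proof (rule hyperbolic_local_to_global[OF fin(1)])
      show "T u v w = T v u w" "T u v w = T u w v" for u v w
        by (simp_all add: T_def add_mset_commute)
      show "0 \<le> T u v w" for u v w
        unfolding T_def by (rule deriv_at_one_nonneg[OF c])
      show "hyperbolic_at_one V (T w)" if "w \<in> V" for w
      proof -
        have "n - size (add_mset w M) < n - size M" using sz by simp
        from less.hyps[OF this] show ?thesis
          unfolding T_def[abs_def] using that less.prems sz by simp
      qed
      show "(u, v) \<in> {(a, b). a \<in> V \<and> b \<in> V \<and> (\<Sum>w\<in>V. T w a b) > 0}\<^sup>*"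
        if "u \<in> V" "v \<in> V" "(\<Sum>w\<in>V. \<Sum>z\<in>V. T z u w) > 0" "(\<Sum>w\<in>V. \<Sum>z\<in>V. T z v w) > 0" for u v
      proof -
        have "{(a, b). a \<in> V \<and> b \<in> V \<and> (\<Sum>w\<in>V. T w a b) > 0} =
          {(a, b). a \<in> V \<and> b \<in> V \<and> ?G (add_mset a (add_mset b M)) > 0}"
          using E d by (auto simp: zero_less_mult_iff)
        moreover have "d * (d + 1) > 0" using d by simp
        then have "?G (add_mset u M) > 0" "?G (add_mset v M) > 0"
          using that(3,4) unfolding row[OF that(1)] row[OF that(2)] by (metis zero_less_mult_pos)+
        ultimately show ?thesis using conn[OF less.prems(1) sz that(1,2)] by simp
      qed
    qed
    then have "hyperbolic_at_one V (\<lambda>u v. d * ?G (add_mset u (add_mset v M)))"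
      unfolding hyperbolic_at_one_def by (simp add: E cong: sum.cong)
    then show ?thesis by (rule hyperbolic_at_one_scale) (use d in simp)
  qed
qed

section \<open>Quadratic forms satisfying the exchange inequalities\<close>

context
  fixes T :: "'a set" and c1 :: "'a \<Rightarrow> real" and c2 :: "'a \<Rightarrow> 'a \<Rightarrow> real"
  assumes fin: "finite T"
    and c1: "\<And>i. i \<in> T \<Longrightarrow> 0 \<le> c1 i"
    and c2: "\<And>i j. i \<in> T \<Longrightarrow> j \<in> T \<Longrightarrow> 0 \<le> c2 i j"
    and sym: "\<And>i j. i \<in> T \<Longrightarrow> j \<in> T \<Longrightarrow> c2 i j = c2 j i"
    and diag: "\<And>i. i \<in> T \<Longrightarrow> c2 i i = 0"
    and tri: "\<And>i j k. i \<in> T \<Longrightarrow> j \<in> T \<Longrightarrow> k \<in> T \<Longrightarrow> i \<noteq> j \<Longrightarrow> i \<noteq> k \<Longrightarrow> j \<noteq> k \<Longrightarrow>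
      c2 i j * c1 k \<le> max (c1 j * c2 i k) (c1 i * c2 j k)"
begin

text \<open>Dividing \<open>c2 i j\<close> by \<open>c1 i * c1 j\<close> turns the exchange inequality \<open>tri\<close> into the ultrametric inequality.\<close>

lemma scaled_ultrametric_bound:
  assumes P: "P = {i \<in> T. c1 i > 0}" "P \<noteq> {}"
    and R: "\<And>i j. i \<in> P \<Longrightarrow> j \<in> P \<Longrightarrow> c2 i j \<le> R * (c1 i * c1 j)"
  shows "(\<Sum>i\<in>P. \<Sum>j\<in>P. c2 i j * x i * x j) \<le> R * (1 - 1 / card P) * (\<Sum>i\<in>P. c1 i * x i)\<^sup>2"
proof -
  define r where "r i j = c2 i j / (c1 i * c1 j)" for i j
  have PT: "i \<in> T" "c1 i > 0" if "i \<in> P" for i using that P by auto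
  have "(\<Sum>i\<in>P. \<Sum>j\<in>P. r i j * (c1 i * x i) * (c1 j * x j)) \<le> R * (1 - 1 / card P) * (\<Sum>i\<in>P. c1 i * x i)\<^sup>2"
  proof (rule ultrametric_form_bound)
    show "r i j \<le> max (r i k) (r k j)" if "i \<in> P" "j \<in> P" "k \<in> P" for i j k
    proof (cases "i = j \<or> i = k \<or> j = k")
      case True
      have "0 \<le> r a b" "r a a = 0" if "a \<in> P" "b \<in> P" for a b
        using that c1 c2 diag PT by (simp_all add: r_def)
      with True that show ?thesis by (auto simp: le_max_iff_disj)
    next
      case False
      then have "c2 i j * c1 k \<le> c1 j * c2 i k \<or> c2 i j * c1 k \<le> c1 i * c2 k j"
        using tri[of i j k] that PT(1) sym[of j k] by (auto simp: le_max_iff_disj)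
      then show ?thesis
      proof
        assume "c2 i j * c1 k \<le> c1 j * c2 i k"
        then have "r i j \<le> r i k"
          using PT(2)[OF that(1)] PT(2)[OF that(2)] PT(2)[OF that(3)] by (simp add: r_def field_simps)
        then show ?thesis by simp
      next
        assume "c2 i j * c1 k \<le> c1 i * c2 k j"
        then have "r i j \<le> r k j"
          using PT(2)[OF that(1)] PT(2)[OF that(2)] PT(2)[OF that(3)] by (simp add: r_def field_simps)
        then show ?thesis by simp
      qed
    qed
    show "r i j \<le> R" if "i \<in> P" "j \<in> P" for i j
      using R[OF that] PT[OF that(1)] PT[OF that(2)] by (simp add: r_def divide_le_eq)
  qed (use P fin c2 sym diag in \<open>auto simp: r_def mult.commute\<close>)
  also have "(\<Sum>i\<in>P. \<Sum>j\<in>P. r i j * (c1 i * x i) * (c1 j * x j)) = (\<Sum>i\<in>P. \<Sum>j\<in>P. c2 i j * x i * x j)"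
  proof (intro sum.cong refl)
    fix i j assume "i \<in> P" "j \<in> P"
    then have "c1 i \<noteq> 0" "c1 j \<noteq> 0" using PT by force+
    then show "r i j * (c1 i * x i) * (c1 j * x j) = c2 i j * x i * x j" by (simp add: r_def)
  qed
  finally show ?thesis .
qed

text \<open>The bound by \<open>R\<close> makes \<open>c2\<close> vanish wherever \<open>c1\<close>
  does, so only points with \<open>c1 i > 0\<close> contribute. There are at most \<open>m\<close>
  of them, and \<open>1 - 1 / m\<close> increases with \<open>m\<close>.\<close>

lemma exchange_form_bound:
  assumes R: "R \<ge> 0" "\<And>i j. i \<in> T \<Longrightarrow> j \<in> T \<Longrightarrow> c2 i j \<le> R * (c1 i * c1 j)"
    and m: "card T \<le> m" "1 \<le> m"
  shows "(\<Sum>i\<in>T. \<Sum>j\<in>T. c2 i j * x i * x j) \<le> R * (1 - 1 / m) * (\<Sum>i\<in>T. c1 i * x i)\<^sup>2"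
proof -
  define P where "P = {i \<in> T. c1 i > 0}"
  have PT: "P \<subseteq> T" "finite P" using fin by (auto simp: P_def)
  have z: "c1 i = 0" if "i \<in> T" "i \<notin> P" for i using that c1[of i] by (auto simp: P_def)
  have z2: "c2 i j = 0" if "i \<in> T" "j \<in> T" "i \<notin> P \<or> j \<notin> P" for i j
    using z that R(2)[of i j] c2[of i j] by fastforce
  have "(\<Sum>i\<in>T. \<Sum>j\<in>T. c2 i j * x i * x j) = (\<Sum>i\<in>P. \<Sum>j\<in>T. c2 i j * x i * x j)"
    using PT z2 by (intro sum.mono_neutral_right fin) auto
  also have "\<dots> = (\<Sum>i\<in>P. \<Sum>j\<in>P. c2 i j * x i * x j)"
    using PT z2 by (intro sum.cong refl sum.mono_neutral_right fin) auto
  also have "\<dots> \<le> R * (1 - 1 / m) * (\<Sum>i\<in>P. c1 i * x i)\<^sup>2"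
  proof (cases "P = {}")
    case False
    then have "0 < card P" "card P \<le> m"
      using PT m fin by (auto simp: card_gt_0_iff intro: order_trans[OF card_mono])
    then have "1 / real m \<le> 1 / real (card P)" by (intro divide_left_mono) auto
    then have "R * (1 - 1 / card P) * (\<Sum>i\<in>P. c1 i * x i)\<^sup>2 \<le> R * (1 - 1 / m) * (\<Sum>i\<in>P. c1 i * x i)\<^sup>2"
      using R(1) by (intro mult_right_mono mult_left_mono) auto
    with scaled_ultrametric_bound[OF P_def False, of R x] R(2) PT show ?thesis
      by (meson order_trans subsetD)
  qed simp
  also have "(\<Sum>i\<in>P. c1 i * x i) = (\<Sum>i\<in>T. c1 i * x i)"
    using PT z by (intro sum.mono_neutral_left fin) auto
  finally show ?thesis .
qed

text \<open>Entries between two zeros of \<open>c1\<close> vanish. Mixed entries are proportional to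
  \<open>c1 i\<close> in the index with \<open>c1 i > 0\<close>, so the mixed part is zero on the
  hyperplane. What remains is covered by the ultrametric bound.\<close>

lemma exchange_form_nonpos_on_hyperplane:
  assumes k: "k \<in> T" "c1 k > 0" and S: "(\<Sum>i\<in>T. c1 i * x i) = 0"
  shows "(\<Sum>i\<in>T. \<Sum>j\<in>T. c2 i j * x i * x j) \<le> 0"
proof -
  define P where "P = {i \<in> T. c1 i > 0}"
  define Z where "Z = T - P"
  have PZ: "P \<union> Z = T" "P \<inter> Z = {}" "finite P" "finite Z" "k \<in> P" "P \<noteq> {}"
    using fin k by (auto simp: P_def Z_def)
  have inT: "i \<in> P \<Longrightarrow> i \<in> T" "i \<in> Z \<Longrightarrow> i \<in> T" for i using PZ by auto
  have z: "c1 i = 0" if "i \<in> Z" for i using that c1[of i] by (auto simp: P_def Z_def)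
  have SP: "(\<Sum>i\<in>P. c1 i * x i) = 0"
    using S z sum.union_disjoint[OF PZ(3,4,2), of "\<lambda>i. c1 i * x i"] unfolding PZ(1) by simp
  \<comment> \<open>Since \<open>c1 j = 0\<close>, one alternative disappears in each of the
    exchange inequalities for \<open>i, j, k\<close> and for \<open>k, j, i\<close>; together they
    give equality.\<close>
  have cross: "c2 i j = c1 i * (c2 k j / c1 k)" if "i \<in> P" "j \<in> Z" for i j
  proof (cases "i = k")
    case False
    have d: "i \<noteq> j" "k \<noteq> j" using that PZ by auto
    have "c2 i j * c1 k \<le> c1 i * c2 k j"
      using tri[of i j k] False d inT that z[OF that(2)] k sym[of j k] c1[of i] c2[of k j] by auto
    moreover have "c2 k j * c1 i \<le> c1 k * c2 i j"
      using tri[of k j i] False d inT that z[OF that(2)] k sym[of j i] c1[of k] c2[of i j] by auto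
    ultimately show ?thesis using k by (simp add: field_simps)
  qed (use k in auto)
  have ZZ: "c2 i j = 0" if "i \<in> Z" "j \<in> Z" for i j
  proof (cases "i = j")
    case False
    have "i \<noteq> k" "j \<noteq> k" using that PZ by auto
    then have "c2 i j * c1 k \<le> 0"
      using tri[of i j k] False inT that k z[OF that(1)] z[OF that(2)] by auto
    then show ?thesis using k c2[of i j] inT that by (simp add: mult_le_0_iff)
  qed (use that inT diag in auto)
  \<comment> \<open>Any bound for the ratios serves, as it is multiplied by a vanishing square; the
    sum of all ratios is one.\<close>
  define R where "R = (\<Sum>i\<in>P. \<Sum>j\<in>P. c2 i j / (c1 i * c1 j))"
  have "c2 i j \<le> R * (c1 i * c1 j)" if ij: "i \<in> P" "j \<in> P" for i j
  proof -
    have nn: "0 \<le> c2 i j / (c1 i * c1 j)" if "i \<in> P" "j \<in> P" for i j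
      using that c1 c2 inT by simp
    have "c2 i j / (c1 i * c1 j) \<le> (\<Sum>j\<in>P. c2 i j / (c1 i * c1 j))"
      using nn ij PZ by (intro member_le_sum[where f = "\<lambda>j. c2 i j / (c1 i * c1 j)"]) auto
    also have "\<dots> \<le> R"
      unfolding R_def using nn ij PZ
      by (intro member_le_sum[where f = "\<lambda>i. \<Sum>j\<in>P. c2 i j / (c1 i * c1 j)"]) (auto intro!: sum_nonneg)
    finally show ?thesis using ij by (simp add: P_def divide_le_eq)
  qed
  from scaled_ultrametric_bound[OF P_def PZ(6) this, of x]
  have PP: "(\<Sum>i\<in>P. \<Sum>j\<in>P. c2 i j * x i * x j) \<le> 0" by (simp add: SP)
  have "(\<Sum>i\<in>P. \<Sum>j\<in>Z. c2 i j * x i * x j) = (\<Sum>i\<in>P. \<Sum>j\<in>Z. (c1 i * x i) * ((c2 k j / c1 k) * x j))"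
    by (intro sum.cong refl) (simp add: cross)
  also have "\<dots> = 0" unfolding sum_product[symmetric] SP by simp
  finally have PZ0: "(\<Sum>i\<in>P. \<Sum>j\<in>Z. c2 i j * x i * x j) = 0" .
  have "(\<Sum>i\<in>T. \<Sum>j\<in>T. c2 i j * x i * x j) =
       (\<Sum>i\<in>P. \<Sum>j\<in>P. c2 i j * x i * x j) + (\<Sum>i\<in>Z. \<Sum>j\<in>Z. c2 i j * x i * x j)
       + 2 * (\<Sum>i\<in>P. \<Sum>j\<in>Z. c2 i j * x i * x j)"
    unfolding PZ(1)[symmetric] using PZ sym inT by (intro double_sum_Un) auto
  then show ?thesis using PP PZ0 by (simp add: ZZ)
qed

end

text \<open>The hyperplane is chosen by the lowest level that has a positive coefficient:
  \<open>c0\<close> together with \<open>c1\<close>, then \<open>c1\<close> alone, then one row of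
  \<open>c2\<close>.\<close>

lemma degree_two_form_nonpos:
  fixes c0 :: real and c1 :: "'a \<Rightarrow> real" and c2 :: "'a \<Rightarrow> 'a \<Rightarrow> real"
  assumes fin: "finite T" and m: "card T \<le> m" "1 \<le> m"
    and c0: "0 \<le> c0"
    and c1: "\<And>i. i \<in> T \<Longrightarrow> 0 \<le> c1 i"
    and c2: "\<And>i j. i \<in> T \<Longrightarrow> j \<in> T \<Longrightarrow> 0 \<le> c2 i j"
    and sym: "\<And>i j. i \<in> T \<Longrightarrow> j \<in> T \<Longrightarrow> c2 i j = c2 j i"
    and diag: "\<And>i. i \<in> T \<Longrightarrow> c2 i i = 0"
    and e1: "\<And>i j. i \<in> T \<Longrightarrow> j \<in> T \<Longrightarrow> i \<noteq> j \<Longrightarrow> c2 i j * c0 \<le> c1 i * c1 j"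
    and e2: "\<And>i j k. i \<in> T \<Longrightarrow> j \<in> T \<Longrightarrow> k \<in> T \<Longrightarrow> i \<noteq> j \<Longrightarrow> i \<noteq> k \<Longrightarrow> j \<noteq> k \<Longrightarrow>
      c2 i j * c1 k \<le> max (c1 j * c2 i k) (c1 i * c2 j k)"
    and e3: "\<And>i j k l. (\<And>i. i \<in> T \<Longrightarrow> c1 i = 0) \<Longrightarrow> i \<in> T \<Longrightarrow> j \<in> T \<Longrightarrow> k \<in> T \<Longrightarrow> l \<in> T \<Longrightarrow>
      distinct [i, j, k, l] \<Longrightarrow> c2 i j * c2 k l \<le> max (c2 k j * c2 i l) (c2 k i * c2 j l)"
  obtains l0 l1 where "\<And>x0 x. l0 * x0 + (\<Sum>i\<in>T. l1 i * x i) = 0 \<Longrightarrow>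
     real m * (real m - 1) * c0 * x0\<^sup>2 + 2 * (real m - 1) * x0 * (\<Sum>i\<in>T. c1 i * x i)
       + (\<Sum>i\<in>T. \<Sum>j\<in>T. c2 i j * x i * x j) \<le> 0"
proof -
  consider "c0 > 0" | k where "c0 = 0" "k \<in> T" "c1 k > 0"
    | "c0 = 0" "\<And>i. i \<in> T \<Longrightarrow> c1 i = 0"
    using c0 c1 by (metis less_eq_real_def)
  then show thesis
  proof cases
    case 1
    show thesis
    \<comment> \<open>The derivative of the form in \<open>x0\<close> is \<open>2 * (m - 1)\<close>
      times this linear form. On its kernel the terms containing \<open>x0\<close> add up to
      \<open>- m * (m - 1) * c0 * x0\<^sup>2\<close>, which the factor \<open>1 - 1 / m\<close> of
      the ultrametric bound balances exactly.\<close>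
    proof (rule that[of "real m * c0" c1])
      fix x0 x
      let ?S = "\<Sum>i\<in>T. c1 i * x i"
      assume l: "real m * c0 * x0 + ?S = 0"
      have "(\<Sum>i\<in>T. \<Sum>j\<in>T. c2 i j * x i * x j) \<le> (1 / c0) * (1 - 1 / m) * ?S\<^sup>2"
      proof (rule exchange_form_bound[OF fin c1 c2 sym diag e2 _ _ m])
        show "c2 i j \<le> 1 / c0 * (c1 i * c1 j)" if "i \<in> T" "j \<in> T" for i j
          using e1[of i j] that 1 c1 diag by (cases "i = j") (auto simp: field_simps)
      qed (use 1 in auto)
      moreover have S: "?S = - (real m * c0 * x0)" using l by simp
      moreover have "(1 / c0) * (1 - 1 / m) * (real m * c0 * x0)\<^sup>2 = real m * (real m - 1) * c0 * x0\<^sup>2"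
        using 1 m by (simp add: field_simps power2_eq_square)
      ultimately show "real m * (real m - 1) * c0 * x0\<^sup>2 + 2 * (real m - 1) * x0 * ?S
       + (\<Sum>i\<in>T. \<Sum>j\<in>T. c2 i j * x i * x j) \<le> 0"
        unfolding S by (simp add: algebra_simps power2_eq_square)
    qed
  next
    case (2 k)
    show thesis
    proof (rule that[of 0 c1])
      fix x0 x
      assume "0 * x0 + (\<Sum>i\<in>T. c1 i * x i) = 0"
      then show "real m * (real m - 1) * c0 * x0\<^sup>2 + 2 * (real m - 1) * x0 * (\<Sum>i\<in>T. c1 i * x i)
       + (\<Sum>i\<in>T. \<Sum>j\<in>T. c2 i j * x i * x j) \<le> 0"
        using exchange_form_nonpos_on_hyperplane[where ?c1.0 = c1 and ?c2.0 = c2 and x = x,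
            OF fin c1 c2 sym diag e2 2(2,3)] 2 by simp
    qed
  next
    case 3
    show thesis
    proof (cases "\<exists>k\<in>T. \<exists>l\<in>T. c2 k l > 0")
      case False
      then have "c2 i j = 0" if "i \<in> T" "j \<in> T" for i j using that c2 by (metis less_eq_real_def)
      then show thesis using 3 by (intro that[of 0 c1]) simp
    next
      case True
      then obtain k l where kl: "k \<in> T" "l \<in> T" "c2 k l > 0" by blast
      then have "l \<noteq> k" using diag by force
      define T' where "T' = T - {k}"
      have T': "finite T'" "l \<in> T'" "{k} \<union> T' = T" "{k} \<inter> T' = {}"
        using fin kl \<open>l \<noteq> k\<close> by (auto simp: T'_def)
      have sub: "i \<in> T" if "i \<in> T'" for i using that by (simp add: T'_def)
      \<comment> \<open>the row of \<open>k\<close> takes over the role of \<open>c1\<close>\<close>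
      show thesis
      proof (rule that[of 0 "c2 k"])
        fix x0 x
        assume "0 * x0 + (\<Sum>i\<in>T. c2 k i * x i) = 0"
        then have S: "(\<Sum>i\<in>T'. c2 k i * x i) = 0"
          using sum.union_disjoint[OF _ T'(1,4), of "\<lambda>i. c2 k i * x i"] diag[OF kl(1)]
          unfolding T'(3) by simp
        have le: "(\<Sum>i\<in>T'. \<Sum>j\<in>T'. c2 i j * x i * x j) \<le> 0"
        proof (rule exchange_form_nonpos_on_hyperplane[where ?c1.0 = "c2 k" and k = l])
          show "c2 i j * c2 k p \<le> max (c2 k j * c2 i p) (c2 k i * c2 j p)"
            if "i \<in> T'" "j \<in> T'" "p \<in> T'" "i \<noteq> j" "i \<noteq> p" "j \<noteq> p" for i j p
            using e3[OF 3(2), of i j k p] that kl by (auto simp: T'_def)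
        qed (use T' S sub kl c2 sym diag in auto)
        have "(\<Sum>i\<in>T. \<Sum>j\<in>T. c2 i j * x i * x j) =
          (\<Sum>i\<in>{k}. \<Sum>j\<in>{k}. c2 i j * x i * x j) + (\<Sum>i\<in>T'. \<Sum>j\<in>T'. c2 i j * x i * x j)
          + 2 * (\<Sum>i\<in>{k}. \<Sum>j\<in>T'. c2 i j * x i * x j)"
          unfolding T'(3)[symmetric] using T' sym kl sub by (intro double_sum_Un) auto
        also have "(\<Sum>i\<in>{k}. \<Sum>j\<in>T'. c2 i j * x i * x j) = x k * (\<Sum>j\<in>T'. c2 k j * x j)"
          by (simp add: sum_distrib_left mult_ac)
        finally show "real m * (real m - 1) * c0 * x0\<^sup>2 + 2 * (real m - 1) * x0 * (\<Sum>i\<in>T. c1 i * x i)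
          + (\<Sum>i\<in>T. \<Sum>j\<in>T. c2 i j * x i * x j) \<le> 0"
          using le S diag[OF kl(1)] 3 by simp
      qed
    qed
  qed
qed

section \<open>Connectivity for the homogenized polynomial\<close>

text \<open>Exponential form of the exchange property: sums of exponents become products of
  coefficients, and the exponent \<open>-\<infinity>\<close> becomes the coefficient 0.\<close>

definition multiplicative_exchange :: "'a set \<Rightarrow> ('a set \<Rightarrow> real) \<Rightarrow> bool" where
  "multiplicative_exchange E c \<longleftrightarrow> (\<forall>I. I \<subseteq> E \<longrightarrow> 0 \<le> c I) \<and>
     (\<forall>I1 I2 i. I1 \<subseteq> E \<longrightarrow> I2 \<subseteq> E \<longrightarrow> i \<in> I1 - I2 \<longrightarrow>
        c I1 * c I2 \<le> c (I1 - {i}) * c (insert i I2) \<or>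
        (\<exists>j \<in> I2 - I1. c I1 * c I2 \<le> c (insert j (I1 - {i})) * c (insert i (I2 - {j}))))"

text \<open>The monomial \<open>x\<^sub>0\<^bsup>n - card I\<^esup> \<Prod>i\<in>I. x\<^sub>i\<close>, with \<open>None\<close> as the index of the homogenizing variable.\<close>

definition homog_exponent :: "'a set \<Rightarrow> 'a set \<Rightarrow> 'a option multiset" where
  "homog_exponent E I = image_mset Some (mset_set I) + replicate_mset (card E - card I) None"

abbreviation homog_vars :: "'a set \<Rightarrow> 'a option set" where
  "homog_vars E \<equiv> insert None (Some ` E)"

abbreviation homog_deriv :: "'a set \<Rightarrow> ('a set \<Rightarrow> real) \<Rightarrow> 'a option multiset \<Rightarrow> real" where
  "homog_deriv E c \<equiv> deriv_at_one (homog_vars E) (Pow E) c (homog_exponent E)"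

lemma count_image_mset_Some: "count (image_mset Some M) (Some i) = count M i"
  by (induction M) auto

lemma count_homog_exponent:
  assumes "finite I"
  shows "count (homog_exponent E I) None = card E - card I"
    and "count (homog_exponent E I) (Some i) = (if i \<in> I then 1 else 0)"
  using assms by (auto simp: homog_exponent_def count_image_mset_Some count_eq_zero_iff)

lemma homog_exponent_props:
  assumes "finite E" "I \<subseteq> E"
  shows "set_mset (homog_exponent E I) \<subseteq> homog_vars E" "size (homog_exponent E I) = card E"
proof -
  have "finite I" "card I \<le> card E" using assms finite_subset card_mono by blast+
  then show "set_mset (homog_exponent E I) \<subseteq> homog_vars E" "size (homog_exponent E I) = card E"
    using assms by (auto simp: homog_exponent_def split: if_splits)
qed

lemma sum_homog_vars:
  assumes "finite E"
  shows "(\<Sum>u\<in>homog_vars E. g u) = g None + (\<Sum>i\<in>E. g (Some i))"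
  using assms by (simp add: sum.reindex)

text \<open>A derivative of full order sees a single monomial: \<open>M\<close> divides a monomial
  of the same degree only if both agree. The factorial comes from the power of the homogenizing
  variable, as all other exponents are at most one.\<close>

lemma homog_deriv_top:
  assumes E: "finite E" and M: "set_mset M \<subseteq> homog_vars E" "size M = card E"
    and c: "\<And>I. I \<subseteq> E \<Longrightarrow> 0 \<le> c I"
  shows "homog_deriv E c M =
    (if \<forall>i. count M (Some i) \<le> 1 then c {i. Some i \<in># M} * fact (count M None) else 0)"
proof (cases "\<forall>i. count M (Some i) \<le> 1")
  case False
  then obtain i where i: "count M (Some i) > 1" by (auto simp: not_le)
  have "\<not> M \<subseteq># homog_exponent E I" if "I \<subseteq> E" for I
    using i count_homog_exponent(2)[OF finite_subset[OF that E], of E i]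
    by (metis One_nat_def less_one linorder_not_less mset_subset_eq_count order_less_le_trans zero_less_one_class.zero_le_one)
  then have "\<not> homog_deriv E c M > 0"
    using deriv_at_one_pos_iff[of "homog_vars E" "Pow E" M c "homog_exponent E"] E M c by auto
  moreover have "homog_deriv E c M \<ge> 0" by (rule deriv_at_one_nonneg) (use c in auto)
  ultimately have "homog_deriv E c M = 0" by linarith
  then show ?thesis by (simp only: if_not_P[OF False])
next
  case True
  define J where "J = {i. Some i \<in># M}"
  have JE: "J \<subseteq> E" using M by (auto simp: J_def)
  have finJ: "finite J" using JE E finite_subset by blast
  have cntS: "count M (Some i) = (if i \<in> J then 1 else 0)" for i
    using True[rule_format, of i] by (auto simp: J_def count_eq_zero_iff le_Suc_eq)
  have "card E = (\<Sum>u\<in>homog_vars E. count M u)"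
    using sum_count_eq_size[of "homog_vars E" M] E M by simp
  also have "\<dots> = count M None + (\<Sum>i\<in>E. if i \<in> J then 1 else 0)"
    unfolding sum_homog_vars[OF E] by (simp add: cntS)
  also have "(\<Sum>i\<in>E. if i \<in> J then 1 else 0) = card J"
    using JE E by (simp add: sum.If_cases Int_absorb1 flip: card_eq_sum)
  finally have cntN: "card E = count M None + card J" .
  have MJ: "M = homog_exponent E J"
  proof (rule multiset_eqI)
    show "count M u = count (homog_exponent E J) u" for u
      by (cases u) (use cntN in \<open>simp_all add: count_homog_exponent[OF finJ] cntS\<close>)
  qed
  have other: "(\<Prod>v\<in>homog_vars E. ffall (count (homog_exponent E I) v) (count M v)) = 0"
    if "I \<in> Pow E - {J}" for I
  proof -
    have I: "I \<subseteq> E" "finite I" "I \<noteq> J" using that E finite_subset by auto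
    have "\<not> M \<subseteq># homog_exponent E I"
    proof
      assume "M \<subseteq># homog_exponent E I"
      then have eq: "M = homog_exponent E I"
        using homog_exponent_props(2)[OF E I(1)] M(2)
        by (metis mset_subset_size order_less_irrefl subset_mset.less_le)
      have "i \<in> I \<longleftrightarrow> i \<in> J" for i
        using cntS[of i] count_homog_exponent(2)[OF I(2), of E i] eq by (metis one_neq_zero)
      then show False using I by blast
    qed
    then have "\<not> (\<Prod>v\<in>homog_vars E. ffall (count (homog_exponent E I) v) (count M v)) > 0"
      by (subst prod_ffall_pos_iff) (use E M in auto)
    moreover have "(\<Prod>v\<in>homog_vars E. ffall (count (homog_exponent E I) v) (count M v)) \<ge> 0"
      by (intro prod_nonneg) (simp add: ffall_nonneg)
    ultimately show ?thesis by linarith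
  qed
  have "(\<Sum>I\<in>Pow E - {J}. c I * (\<Prod>v\<in>homog_vars E. ffall (count (homog_exponent E I) v) (count M v))) = 0"
    by (intro sum.neutral ballI) (simp only: other mult_zero_right)
  then have "homog_deriv E c M = c J * (\<Prod>v\<in>homog_vars E. ffall (count M v) (count M v))"
    unfolding deriv_at_one_def using E JE by (subst sum.remove[of _ J]) (simp_all add: MJ)
  also have "(\<Prod>v\<in>homog_vars E. ffall (count M v) (count M v)) = fact (count M None) * (\<Prod>i\<in>E. fact (count M (Some i)))"
    using E by (simp add: prod.reindex ffall_self)
  also have "(\<Prod>i\<in>E. fact (count M (Some i))) = (1::real)"
    by (intro prod.neutral) (simp add: cntS)
  finally show ?thesis by (simp only: if_P[OF True] J_def mult_1_right)
qed

context
  fixes E :: "'a set" and c :: "'a set \<Rightarrow> real"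
  assumes E: "finite E" and exch: "multiplicative_exchange E c"
begin

lemma c_nonneg: "I \<subseteq> E \<Longrightarrow> 0 \<le> c I"
  using exch by (simp add: multiplicative_exchange_def)

lemma exchange_cases:
  assumes "I1 \<subseteq> E" "I2 \<subseteq> E" "i \<in> I1" "i \<notin> I2"
  obtains (drop) "c I1 * c I2 \<le> c (I1 - {i}) * c (insert i I2)"
    | (swap) j where "j \<in> I2" "j \<notin> I1" "c I1 * c I2 \<le> c (insert j (I1 - {i})) * c (insert i (I2 - {j}))"
proof -
  have "\<forall>I1 I2 i. I1 \<subseteq> E \<longrightarrow> I2 \<subseteq> E \<longrightarrow> i \<in> I1 - I2 \<longrightarrow>
        c I1 * c I2 \<le> c (I1 - {i}) * c (insert i I2) \<or>
        (\<exists>j \<in> I2 - I1. c I1 * c I2 \<le> c (insert j (I1 - {i})) * c (insert i (I2 - {j})))"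
    using exch unfolding multiplicative_exchange_def by blast
  from this[rule_format, of I1 I2 i] assms show thesis using drop swap by blast
qed

text \<open>A positive left side of the exchange inequality forces both nonnegative factors on the
  right to be positive, so the support inherits the exchange property.\<close>

lemma exchange_support:
  assumes "I1 \<subseteq> E" "I2 \<subseteq> E" "i \<in> I1" "i \<notin> I2" "c I1 > 0" "c I2 > 0"
  obtains (drop) "c (I1 - {i}) > 0" "c (insert i I2) > 0"
    | (swap) j where "j \<in> I2" "j \<notin> I1" "c (insert j (I1 - {i})) > 0" "c (insert i (I2 - {j})) > 0"
proof -
  have pos: "a > 0" "b > 0" if "c I1 * c I2 \<le> a * b" "a \<ge> 0" "b \<ge> 0" for a b
  proof -
    have "a * b > 0" using that assms by (meson mult_pos_pos less_le_trans)
    then show "a > 0" "b > 0" using that by (auto simp: zero_less_mult_iff)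
  qed
  have iE: "i \<in> E" using assms by blast
  show thesis
    using assms(1-4)
  proof (cases rule: exchange_cases)
    case drop
    have "c (I1 - {i}) \<ge> 0" "c (insert i I2) \<ge> 0" using assms iE by (auto intro!: c_nonneg)
    from pos[OF drop this] show thesis by (rule that(1))
  next
    case (swap j)
    have "c (insert j (I1 - {i})) \<ge> 0" "c (insert i (I2 - {j})) \<ge> 0"
      using assms iE swap by (auto intro!: c_nonneg)
    from pos[OF swap(3) this] swap(1,2) show thesis by (intro that(2))
  qed
qed

text \<open>Each monomial with positive coefficient that is divisible by \<open>M\<close> joins all
  variables left in it. If one of them keeps a factor \<open>None\<close>, every vertex is linked to
  \<open>None\<close>; otherwise all such sets have equal size, and swaps link any two
  vertices.\<close>

lemma homog_connected:
  assumes M: "set_mset M \<subseteq> homog_vars E" "size M + 3 \<le> card E"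
    and uv: "u \<in> homog_vars E" "v \<in> homog_vars E"
    and pos: "homog_deriv E c (add_mset u M) > 0" "homog_deriv E c (add_mset v M) > 0"
  shows "(u, v) \<in> {(a, b). a \<in> homog_vars E \<and> b \<in> homog_vars E \<and>
      homog_deriv E c (add_mset a (add_mset b M)) > 0}\<^sup>*" (is "_ \<in> ?R\<^sup>*")
proof -
  define n where "n = card E"
  define a where "a = count M None"
  define J where "J = {i. Some i \<in># M}"
  have pos_iff: "homog_deriv E c K > 0 \<longleftrightarrow> (\<exists>I. I \<subseteq> E \<and> c I > 0 \<and> K \<subseteq># homog_exponent E I)"
    if "set_mset K \<subseteq> homog_vars E" for K
    using deriv_at_one_pos_iff[of "homog_vars E" "Pow E" K c "homog_exponent E"] E that c_nonneg by auto
  have sub_iff: "K \<subseteq># homog_exponent E I \<longleftrightarrow>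
      count K None + card I \<le> n \<and> (\<forall>i. count K (Some i) \<le> (if i \<in> I then 1 else 0))" if "I \<subseteq> E" for K I
  proof -
    have fI: "finite I" "card I \<le> n" using that E finite_subset card_mono n_def by blast+
    have "(\<forall>u. P u) \<longleftrightarrow> P None \<and> (\<forall>i. P (Some i))" for P :: "'a option \<Rightarrow> bool"
      by (metis option.exhaust)
    then show ?thesis
      unfolding subseteq_mset_def using fI
      by (simp only: count_homog_exponent[OF fI(1)] n_def) (simp add: le_diff_conv2)
  qed
  \<comment> \<open>Positivity of a derivative excludes repeated variables in \<open>M\<close>,
    apart from \<open>None\<close>.\<close>
  have J1: "count M (Some i) = (if i \<in> J then 1 else 0)" for i
  proof -
    obtain I where I: "I \<subseteq> E" "add_mset u M \<subseteq># homog_exponent E I"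
      using pos(1) pos_iff[of "add_mset u M"] uv M by auto
    have "count (add_mset u M) (Some i) \<le> (if i \<in> I then 1 else 0)"
      using I(2) unfolding sub_iff[OF I(1)] by blast
    also have "\<dots> \<le> 1" by simp
    finally have "count M (Some i) \<le> 1" by (auto split: if_splits)
    then show ?thesis by (auto simp: J_def count_eq_zero_iff le_Suc_eq)
  qed
  have finJ: "finite J" "J \<subseteq> E" using M(1) E finite_subset[of J E] by (auto simp: J_def)
  have "size M = (\<Sum>u\<in>homog_vars E. count M u)"
    using sum_count_eq_size[of "homog_vars E" M] E M by simp
  also have "\<dots> = a + (\<Sum>i\<in>E. if i \<in> J then 1 else 0)"
    unfolding sum_homog_vars[OF E] by (simp add: J1 a_def)
  also have "(\<Sum>i\<in>E. if i \<in> J then 1 else 0) = card J"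
    using finJ E by (simp add: sum.If_cases Int_absorb1 flip: card_eq_sum)
  finally have szn: "a + card J + 3 \<le> n" using M(2) by (simp add: n_def)
  \<comment> \<open>The good sets are the monomials of positive coefficient divisible by
    \<open>M\<close>. Strict inequality \<open>card I + a < n\<close> means that a factor
    \<open>None\<close> is left after the derivative.\<close>
  define good where "good I \<longleftrightarrow> I \<subseteq> E \<and> c I > 0 \<and> J \<subseteq> I \<and> card I + a \<le> n" for I
  have le1: "(\<forall>i. count M (Some i) \<le> (if i \<in> I then 1 else 0)) \<longleftrightarrow> J \<subseteq> I" for I
    unfolding J1 by auto
  have degN: "homog_deriv E c (add_mset None M) > 0 \<longleftrightarrow> (\<exists>I. good I \<and> card I + a < n)"
  proof -
    have "add_mset None M \<subseteq># homog_exponent E I \<longleftrightarrow> card I + a < n \<and> J \<subseteq> I" if "I \<subseteq> E" for I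
      using le1[of I] by (simp add: sub_iff[OF that] a_def Suc_le_eq add.commute)
    then show ?thesis using M by (subst pos_iff) (auto simp: good_def intro: less_imp_le)
  qed
  have degS: "homog_deriv E c (add_mset (Some i) M) > 0 \<longleftrightarrow> (\<exists>I. good I \<and> i \<in> I - J)" if "i \<in> E" for i
  proof -
    have "(\<forall>k. count (add_mset (Some i) M) (Some k) \<le> (if k \<in> I then 1 else 0)) \<longleftrightarrow> J \<subseteq> I \<and> i \<in> I - J" for I
      unfolding count_add_mset J1 by (auto split: if_splits)
    then have "add_mset (Some i) M \<subseteq># homog_exponent E I \<longleftrightarrow> card I + a \<le> n \<and> J \<subseteq> I \<and> i \<in> I - J"
      if "I \<subseteq> E" for I
      by (simp only: sub_iff[OF that]) (simp add: a_def add.commute)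
    then show ?thesis using M that by (subst pos_iff) (auto simp: good_def)
  qed
  have adjN: "(None, Some i) \<in> ?R" "(Some i, None) \<in> ?R" if "good I" "i \<in> I - J" "card I + a < n" for i I
  proof -
    have *: "(\<forall>k. count (add_mset None (add_mset (Some i) M)) (Some k) \<le> (if k \<in> I then 1 else 0))"
      using that by (auto simp: J1 good_def)
    have iE: "i \<in> E" using that by (auto simp: good_def)
    have "add_mset None (add_mset (Some i) M) \<subseteq># homog_exponent E I"
      using that * by (subst sub_iff) (auto simp: good_def a_def)
    then have "homog_deriv E c (add_mset None (add_mset (Some i) M)) > 0"
      using M iE that by (subst pos_iff) (auto simp: good_def)
    then show "(None, Some i) \<in> ?R" "(Some i, None) \<in> ?R" using iE by (auto simp: add_mset_commute)
  qed
  have adjS: "(Some i, Some j) \<in> ?R" if "good I" "i \<in> I - J" "j \<in> I - J" "i \<noteq> j" for i j I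
  proof -
    have *: "(\<forall>k. count (add_mset (Some i) (add_mset (Some j) M)) (Some k) \<le> (if k \<in> I then 1 else 0))"
      using that by (auto simp: J1 good_def)
    have iE: "i \<in> E" "j \<in> E" using that by (auto simp: good_def)
    have "add_mset (Some i) (add_mset (Some j) M) \<subseteq># homog_exponent E I"
      using that * by (subst sub_iff) (auto simp: good_def a_def)
    then have "homog_deriv E c (add_mset (Some i) (add_mset (Some j) M)) > 0"
      using M iE that by (subst pos_iff) (auto simp: good_def)
    then show "(Some i, Some j) \<in> ?R" using iE by auto
  qed
  \<comment> \<open>If no factor \<open>None\<close> is left, the assumption
    \<open>size M + 3 \<le> card E\<close> leaves at least three elements in
    \<open>I - J\<close>.\<close>
  have third: "\<exists>l\<in>I - J. l \<noteq> i \<and> l \<noteq> j" if "good I" "card I + a = n" for I i j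
  proof (rule ccontr)
    assume "\<not> ?thesis"
    then have "I \<subseteq> J \<union> {i, j}" by auto
    then have "card I \<le> card (J \<union> {i, j})" using finJ by (intro card_mono) auto
    also have "\<dots> \<le> card J + card {i, j}" by (rule card_Un_le)
    also have "card {i, j} \<le> 2" by (simp add: card_insert_if)
    finally show False using szn that by simp
  qed
  have fin: "finite I" if "good I" for I using that E finite_subset by (auto simp: good_def)
  have swap_good: "good (insert i (I - {k}))" "card (insert i (I - {k})) = card I"
    if "good I" "i \<in> E" "i \<notin> I" "k \<in> I" "k \<notin> J" "c (insert i (I - {k})) > 0" for i k I
  proof -
    show "card (insert i (I - {k})) = card I"
      using fin[OF that(1)] that(3) card_Suc_Diff1[OF fin[OF that(1)] that(4)]
      by (subst card_insert_disjoint) auto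
    then show "good (insert i (I - {k}))" using that by (auto simp: good_def)
  qed
  \<comment> \<open>Exchange brings \<open>i\<close> into \<open>I2\<close>, which has a factor
    \<open>None\<close> to spare. A swap preserves the spare factor, whereas adding \<open>i\<close>
    may use it up.\<close>
  have toN: "(None, Some i) \<in> ?R\<^sup>* \<and> (Some i, None) \<in> ?R\<^sup>*"
    if I2: "good I2" "card I2 + a < n" and I1: "good I1" "i \<in> I1 - J" for i I1 I2
  proof (cases "i \<in> I2 \<or> card I1 + a < n")
    case True
    then have "(None, Some i) \<in> ?R \<and> (Some i, None) \<in> ?R" using adjN I1 I2 by blast
    then show ?thesis by blast
  next
    case False
    have iE: "i \<in> E" using I1 by (auto simp: good_def)
    have props: "I1 \<subseteq> E" "I2 \<subseteq> E" "i \<in> I1" "i \<notin> I2" "c I1 > 0" "c I2 > 0"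
      using I1 I2 False by (auto simp: good_def)
    from props show ?thesis
    proof (cases rule: exchange_support)
      case drop
      have crd: "card (insert i I2) = card I2 + 1" using fin[OF I2(1)] props by simp
      then have g: "good (insert i I2)" using drop I2 iE by (auto simp: good_def)
      show ?thesis
      proof (cases "card (insert i I2) + a < n")
        case True
        then have "(None, Some i) \<in> ?R \<and> (Some i, None) \<in> ?R" using adjN[OF g] I1 by blast
        then show ?thesis by blast
      next
        case False
        then have "card (insert i I2) + a = n" using I2 crd by simp
        \<comment> \<open>The detour goes through \<open>l\<close>: it lies in \<open>I2\<close>,
          hence is adjacent to \<open>None\<close>, and it shares \<open>insert i I2\<close> with
          \<open>i\<close>.\<close>
        then obtain l where l: "l \<in> insert i I2 - J" "l \<noteq> i" using third[OF g] by blast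
        then have "(None, Some l) \<in> ?R" "(Some l, None) \<in> ?R"
          using adjN[OF I2(1) _ I2(2), of l] by blast+
        moreover have "(Some l, Some i) \<in> ?R" "(Some i, Some l) \<in> ?R"
          using adjS[OF g] l I1 by blast+
        ultimately show ?thesis by (meson r_into_rtrancl rtrancl_into_rtrancl)
      qed
    next
      case (swap k)
      have "k \<notin> J" using swap I1 by (auto simp: good_def)
      note g = swap_good[OF I2(1) iE props(4) swap(1) this swap(4)]
      have "(None, Some i) \<in> ?R \<and> (Some i, None) \<in> ?R"
        using adjN[OF g(1), of i] g(2) I1 I2 by auto
      then show ?thesis by blast
    qed
  qed
  have SS: "(Some i, Some j) \<in> ?R\<^sup>*"
    if none: "\<And>I. good I \<Longrightarrow> card I + a = n" and I1: "good I1" "i \<in> I1 - J" and I2: "good I2" "j \<in> I2 - J"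
    for i j I1 I2
  proof (cases "i = j \<or> j \<in> I1 \<or> i \<in> I2")
    case True
    then have "i = j \<or> (Some i, Some j) \<in> ?R" using adjS[OF I1(1)] adjS[OF I2(1)] I1(2) I2(2) by blast
    then show ?thesis by blast
  next
    case False
    have iE: "i \<in> E" using I1 by (auto simp: good_def)
    have props: "I1 \<subseteq> E" "I2 \<subseteq> E" "i \<in> I1" "i \<notin> I2" "c I1 > 0" "c I2 > 0"
      using I1 I2 False by (auto simp: good_def)
    from props show ?thesis
    proof (cases rule: exchange_support)
      case drop
      \<comment> \<open>This alternative is impossible: it would produce a good set with one element
        less, although all good sets have the same size.\<close>
      have crd: "card (I1 - {i}) + 1 = card I1" using card_Suc_Diff1[OF fin[OF I1(1)] props(3)] by simp
      then have g: "good (I1 - {i})" using drop I1 by (auto simp: good_def)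
      then show ?thesis using none[OF g] none[OF I1(1)] crd by simp
    next
      case (swap k)
      have "k \<notin> J" using swap I1 by (auto simp: good_def)
      note g = swap_good[OF I2(1) iE props(4) swap(1) this swap(4)]
      show ?thesis
      proof (cases "k = j")
        case False
        then have "(Some i, Some j) \<in> ?R"
          using adjS[OF g(1), of i j] I1 I2 \<open>\<not> (i = j \<or> j \<in> I1 \<or> i \<in> I2)\<close> by blast
        then show ?thesis by blast
      next
        case True
        \<comment> \<open>The swap has removed \<open>j\<close> itself, so a further element
          \<open>l\<close> of \<open>I2\<close> serves as a bridge: it meets \<open>i\<close> in the
          new set and \<open>j\<close> in \<open>I2\<close>.\<close>
        obtain l where l: "l \<in> I2 - J" "l \<noteq> j" using third[OF I2(1) none[OF I2(1)]] by blast
        have "(Some i, Some l) \<in> ?R"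
          using adjS[OF g(1), of i l] I1 l props True by auto
        moreover have "(Some l, Some j) \<in> ?R" using adjS[OF I2(1)] l I2 by blast
        ultimately show ?thesis by (meson r_into_rtrancl rtrancl_into_rtrancl)
      qed
    qed
  qed
  have witS: "\<exists>I. good I \<and> i \<in> I - J" if "w = Some i" "w \<in> homog_vars E" "homog_deriv E c (add_mset w M) > 0" for w i
    using degS[of i] that by auto
  show ?thesis
  proof (cases "\<exists>I. good I \<and> card I + a < n")
    case True
    then obtain I2 where I2: "good I2" "card I2 + a < n" by blast
    have "(None, w) \<in> ?R\<^sup>* \<and> (w, None) \<in> ?R\<^sup>*"
      if w: "w \<in> homog_vars E" "homog_deriv E c (add_mset w M) > 0" for w
    proof (cases w)
      case (Some i)
      then obtain I1 where "good I1" "i \<in> I1 - J" using witS[OF Some w] by blast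
      from toN[OF I2 this] show ?thesis using Some by simp
    qed simp
    then show ?thesis using uv pos by (meson rtrancl_trans)
  next
    case False
    then have none: "\<And>I. good I \<Longrightarrow> card I + a = n" by (metis good_def le_neq_implies_less)
    obtain i j where ij: "u = Some i" "v = Some j"
      using False degN pos by (metis option.exhaust)
    obtain I1 I2 where "good I1" "i \<in> I1 - J" "good I2" "j \<in> I2 - J"
      using witS[OF ij(1) uv(1) pos(1)] witS[OF ij(2) uv(2) pos(2)] by blast
    from SS[OF none this] show ?thesis using ij by simp
  qed
qed
end

section \<open>Hyperbolicity of all second derivatives\<close>

text \<open>By \<open>homog_deriv_top\<close> every entry is a single coefficient times a factorial.
  After division by \<open>fact a\<close> the form is that of \<open>degree_two_form_nonpos\<close>,
  and its inequalities are exchanges between sets containing \<open>J\<close>.\<close>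

lemma homog_hyperbolic_degree_two:
  assumes E: "finite E" and exch: "multiplicative_exchange E c"
    and M: "set_mset M \<subseteq> homog_vars E" "size M + 2 = card E"
  shows "hyperbolic_at_one (homog_vars E) (\<lambda>u v. homog_deriv E c (add_mset u (add_mset v M)))"
    (is "hyperbolic_at_one ?V ?h")
proof -
  have finV: "finite ?V" using E by simp
  have h_sym: "?h u v = ?h v u" for u v by (simp add: add_mset_commute)
  have h0: "0 \<le> ?h u v" for u v
    by (rule deriv_at_one_nonneg) (use c_nonneg[OF E exch] in auto)
  have top: "?h u v = (if \<forall>i. count (add_mset u (add_mset v M)) (Some i) \<le> 1
      then c {i. Some i \<in># add_mset u (add_mset v M)} * fact (count (add_mset u (add_mset v M)) None) else 0)"
    if "u \<in> ?V" "v \<in> ?V" for u v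
    by (rule homog_deriv_top[OF E]) (use that M c_nonneg[OF E exch] in auto)
  show ?thesis
  proof (cases "\<forall>i. count M (Some i) \<le> 1")
    case False
    then obtain i where i: "\<not> count M (Some i) \<le> 1" by blast
    have "?h u v = 0" if "u \<in> ?V" "v \<in> ?V" for u v
    proof -
      have "count M (Some i) \<le> count (add_mset u (add_mset v M)) (Some i)" by simp
      then have "\<not> count (add_mset u (add_mset v M)) (Some i) \<le> 1" using i by linarith
      then have "\<not> (\<forall>i. count (add_mset u (add_mset v M)) (Some i) \<le> 1)" by blast
      then show ?thesis unfolding top[OF that] by (simp only: if_False)
    qed
    then show ?thesis by (simp add: hyperbolic_at_one_def)
  next
    case True
    define a where "a = count M None"
    define J where "J = {i. Some i \<in># M}"
    have J1: "count M (Some i) = (if i \<in> J then 1 else 0)" for i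
      using True[rule_format, of i] by (auto simp: J_def count_eq_zero_iff le_Suc_eq)
    have finJ: "finite J" "J \<subseteq> E" using M(1) E finite_subset[of J E] by (auto simp: J_def)
    have "size M = (\<Sum>u\<in>?V. count M u)"
      using sum_count_eq_size[of ?V M] E M by simp
    also have "\<dots> = a + (\<Sum>i\<in>E. if i \<in> J then 1 else 0)"
      unfolding sum_homog_vars[OF E] by (simp add: J1 a_def)
    also have "(\<Sum>i\<in>E. if i \<in> J then 1 else 0) = card J"
      using finJ E by (simp add: sum.If_cases Int_absorb1 flip: card_eq_sum)
    finally have szM: "size M = a + card J" .
    define T where "T = E - J"
    have T: "finite T" "T \<subseteq> E" using E by (auto simp: T_def)
    \<comment> \<open>The number of remaining elements equals the number \<open>m\<close> in the
      constant \<open>1 - 1 / m\<close>, so the ultrametric bound fits exactly.\<close>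
    have cardT: "card T = a + 2"
      using szM M(2) finJ E by (simp add: T_def card_Diff_subset)
    define c1 where "c1 i = c (insert i J)" for i
    define c2 where "c2 i j = (if i = j then 0 else c (insert i (insert j J)))" for i j
    have hNN: "?h None None = fact a * (real (a + 2) * (real (a + 2) - 1) * c J)"
      by (subst top) (simp_all add: J1 J_def[symmetric] a_def[symmetric] algebra_simps)
    have hNS: "?h None (Some i) = fact a * ((real (a + 2) - 1) * (if i \<in> T then c1 i else 0))" if "i \<in> E" for i
    proof -
      have "(\<forall>k. count (add_mset None (add_mset (Some i) M)) (Some k) \<le> 1) \<longleftrightarrow> i \<in> T"
        using that by (auto simp: J1 T_def)
      moreover have "{k. Some k \<in># add_mset None (add_mset (Some i) M)} = insert i J"
        by (auto simp: J_def)
      ultimately show ?thesis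
        using that by (subst top) (simp_all add: c1_def a_def[symmetric] algebra_simps)
    qed
    have hSS: "?h (Some i) (Some j) = fact a * (if i \<in> T \<and> j \<in> T then c2 i j else 0)"
      if "i \<in> E" "j \<in> E" for i j
    proof -
      have "(\<forall>k. count (add_mset (Some i) (add_mset (Some j) M)) (Some k) \<le> 1) \<longleftrightarrow> i \<noteq> j \<and> i \<in> T \<and> j \<in> T"
        using that by (auto simp: J1 T_def)
      moreover have "{k. Some k \<in># add_mset (Some i) (add_mset (Some j) M)} = insert i (insert j J)"
        by (auto simp: J_def)
      ultimately show ?thesis
        using that by (subst top) (simp_all add: c2_def a_def[symmetric])
    qed
    have form: "(\<Sum>u\<in>?V. \<Sum>v\<in>?V. ?h u v * x u * x v) = fact a *
        (real (a + 2) * (real (a + 2) - 1) * c J * (x None)\<^sup>2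
         + 2 * (real (a + 2) - 1) * x None * (\<Sum>i\<in>T. c1 i * x (Some i))
         + (\<Sum>i\<in>T. \<Sum>j\<in>T. c2 i j * x (Some i) * x (Some j)))" for x
    proof -
      have 1: "(\<Sum>i\<in>E. ?h None (Some i) * x None * x (Some i)) =
          fact a * ((real (a + 2) - 1) * x None * (\<Sum>i\<in>T. c1 i * x (Some i)))"
      proof -
        have "(\<Sum>i\<in>E. ?h None (Some i) * x None * x (Some i)) =
           (\<Sum>i\<in>T. fact a * ((real (a + 2) - 1) * x None * (c1 i * x (Some i))))"
          using T E by (intro sum.mono_neutral_cong_right) (auto simp: hNS)
        then show ?thesis by (simp add: sum_distrib_left)
      qed
      have 2: "(\<Sum>i\<in>E. \<Sum>j\<in>E. ?h (Some i) (Some j) * x (Some i) * x (Some j)) =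
          fact a * (\<Sum>i\<in>T. \<Sum>j\<in>T. c2 i j * x (Some i) * x (Some j))"
      proof -
        have "(\<Sum>i\<in>E. \<Sum>j\<in>E. ?h (Some i) (Some j) * x (Some i) * x (Some j)) =
          (\<Sum>i\<in>T. \<Sum>j\<in>E. ?h (Some i) (Some j) * x (Some i) * x (Some j))"
          using T E by (intro sum.mono_neutral_right) (auto simp: hSS)
        also have "\<dots> = (\<Sum>i\<in>T. \<Sum>j\<in>T. fact a * (c2 i j * x (Some i) * x (Some j)))"
          using T E by (intro sum.cong[OF refl] sum.mono_neutral_cong_right) (auto simp: hSS subsetD[OF T(2)])
        finally show ?thesis by (simp add: sum_distrib_left)
      qed
      have "(\<Sum>u\<in>?V. \<Sum>v\<in>?V. ?h u v * x u * x v) = ?h None None * x None * x None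
         + 2 * (\<Sum>i\<in>E. ?h None (Some i) * x None * x (Some i))
         + (\<Sum>i\<in>E. \<Sum>j\<in>E. ?h (Some i) (Some j) * x (Some i) * x (Some j))"
        unfolding sum_homog_vars[OF E] sum.distrib h_sym[of "Some _" None]
        by (simp add: mult_ac)
      then show ?thesis unfolding 1 2 hNN by (simp add: algebra_simps power2_eq_square)
    qed
    have in_T: "i \<notin> J" "i \<in> E" if "i \<in> T" for i using that by (auto simp: T_def)
    have exc: "c I1 * c I2 \<le> c (I1 - {i}) * c (insert i I2) \<or>
        (\<exists>j \<in> I2 - I1. c I1 * c I2 \<le> c (insert j (I1 - {i})) * c (insert i (I2 - {j})))"
      if "I1 \<subseteq> E" "I2 \<subseteq> E" "i \<in> I1" "i \<notin> I2" for I1 I2 i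
      by (rule exchange_cases[OF E exch that]) blast+
    have nn: "0 \<le> c (insert i (insert j J))" "0 \<le> c (insert i J)" "0 \<le> c J" if "i \<in> T" "j \<in> T" for i j
      using that in_T finJ by (auto intro!: c_nonneg[OF E exch])
    obtain l0 l1 where l: "\<And>x0 x. l0 * x0 + (\<Sum>i\<in>T. l1 i * x i) = 0 \<Longrightarrow>
       real (a + 2) * (real (a + 2) - 1) * c J * x0\<^sup>2 + 2 * (real (a + 2) - 1) * x0 * (\<Sum>i\<in>T. c1 i * x i)
       + (\<Sum>i\<in>T. \<Sum>j\<in>T. c2 i j * x i * x j) \<le> 0"
    proof (rule degree_two_form_nonpos[where ?c0.0 = "c J" and ?c1.0 = c1 and ?c2.0 = c2 and T = T and m = "a + 2"])
      show "0 \<le> c J" using finJ by (intro c_nonneg[OF E exch])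
      show "c2 i j = c2 j i" for i j by (simp add: c2_def insert_commute)
      show "c2 i j * c J \<le> c1 i * c1 j" if "i \<in> T" "j \<in> T" "i \<noteq> j" for i j
      proof -
        have "insert i (insert j J) - {i} = insert j J" using that in_T by auto
        then show ?thesis
          using exc[of "insert i (insert j J)" J i] that in_T finJ
          by (auto simp: c1_def c2_def mult.commute)
      qed
      show "c2 i j * c1 k \<le> max (c1 j * c2 i k) (c1 i * c2 j k)"
        if "i \<in> T" "j \<in> T" "k \<in> T" "i \<noteq> j" "i \<noteq> k" "j \<noteq> k" for i j k
      proof -
        have s: "insert i (insert j J) - {i} = insert j J" "insert k J - {k} = J"
          "insert k J - insert i (insert j J) = {k}"
          using that in_T by auto
        show ?thesis
          using exc[of "insert i (insert j J)" "insert k J" i] that in_T finJ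
          unfolding s by (auto simp: c1_def c2_def mult.commute insert_commute le_max_iff_disj s)
      qed
      show "c2 i j * c2 k l \<le> max (c2 k j * c2 i l) (c2 k i * c2 j l)"
        if z: "\<And>i. i \<in> T \<Longrightarrow> c1 i = 0" and T4: "i \<in> T" "j \<in> T" "k \<in> T" "l \<in> T"
          and d: "distinct [i, j, k, l]" for i j k l
      proof -
        have s: "insert i (insert j J) - {i} = insert j J" "insert k (insert l J) - {k} = insert l J"
          "insert k (insert l J) - {l} = insert k J"
          "insert k (insert l J) - insert i (insert j J) = {k, l}"
          using T4 d in_T by auto
        \<comment> \<open>The vanishing coefficients \<open>c1\<close> make the alternative of
          dropping \<open>i\<close> trivial, so that only swaps matter.\<close>
        have "c (insert j J) = 0" using z[OF T4(2)] by (simp add: c1_def)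
        moreover have "0 \<le> c2 k j * c2 i l" using nn T4 by (simp add: c2_def)
        ultimately show ?thesis
          using exc[of "insert i (insert j J)" "insert k (insert l J)" i] T4 d in_T finJ
          unfolding s by (auto simp: c2_def mult.commute insert_commute le_max_iff_disj s)
      qed
    qed (use T cardT nn in \<open>auto simp: c1_def c2_def\<close>)
    define L where "L u = (case u of None \<Rightarrow> l0 | Some i \<Rightarrow> if i \<in> T then l1 i else 0)" for u
    show ?thesis
    proof (rule hyperbolic_at_oneI[where l = L, OF finV h_sym h0])
      fix x assume "(\<Sum>u\<in>?V. L u * x u) = 0"
      moreover have "(\<Sum>i\<in>E. L (Some i) * x (Some i)) = (\<Sum>i\<in>T. l1 i * x (Some i))"
        using T E by (intro sum.mono_neutral_cong_right) (auto simp: L_def)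
      ultimately have "l0 * x None + (\<Sum>i\<in>T. l1 i * x (Some i)) = 0"
        unfolding sum_homog_vars[OF E] by (simp add: L_def)
      from l[OF this] show "(\<Sum>u\<in>?V. \<Sum>v\<in>?V. ?h u v * x u * x v) \<le> 0"
        unfolding form by (intro mult_nonneg_nonpos) auto
    qed
  qed
qed

theorem homog_hyperbolic:
  assumes "finite E" "multiplicative_exchange E c"
    and "set_mset M \<subseteq> homog_vars E" "size M + 2 \<le> card E"
  shows "hyperbolic_at_one (homog_vars E) (\<lambda>u v. homog_deriv E c (add_mset u (add_mset v M)))"
proof (rule hyperbolic_deriv_induct[where n = "card E"])
  show "0 \<le> c I" if "I \<in> Pow E" for I using that c_nonneg[OF assms(1,2)] by simp
qed (use assms homog_connected[OF assms(1,2)] homog_hyperbolic_degree_two[OF assms(1,2)]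
    homog_exponent_props[OF assms(1)] in auto)

section \<open>Log-concavity in the homogenizing variable\<close>

lemma homog_deriv_replicate_None:
  assumes "finite E"
  shows "homog_deriv E c (replicate_mset b None) = (\<Sum>I\<in>Pow E. c I * ffall (card E - card I) b)"
proof -
  have "(\<Prod>v\<in>homog_vars E. ffall (count (homog_exponent E I) v) (count (replicate_mset b None) v))
      = ffall (card E - card I) b" if "I \<in> Pow E" for I
    using that assms finite_subset[of I E] by (simp add: prod.reindex count_homog_exponent)
  then show ?thesis by (simp add: deriv_at_one_def)
qed

text \<open>The reversed Cauchy--Schwarz inequality for the second derivatives of \<open>\<partial>\<^sub>0\<^bsup>n-k-1\<^esup> f\<close>
  in the directions \<open>e\<^sub>0\<close> and \<open>1\<close>, where Euler's relation evaluates the derivatives along \<open>1\<close>.\<close>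

lemma homog_deriv_None_log_concave:
  assumes E: "finite E" "multiplicative_exchange E c" and k: "0 < k" "k < card E"
  defines "G \<equiv> \<lambda>b. \<Sum>I\<in>Pow E. c I * ffall (card E - card I) b"
  shows "(k + 1) * G (card E - k + 1) * G (card E - k - 1) \<le> k * (G (card E - k))\<^sup>2"
proof -
  define b where "b = card E - k - 1"
  have b: "card E - k = Suc b" "card E - k + 1 = Suc (Suc b)" "card E = k + b + 1"
    using k by (auto simp: b_def)
  let ?V = "homog_vars E"
  define M where "M = replicate_mset b (None :: 'a option)"
  have M: "set_mset M \<subseteq> ?V" "size M = b" by (auto simp: M_def)
  define h where "h u v = homog_deriv E c (add_mset u (add_mset v M))" for u v
  have G: "G j = homog_deriv E c (replicate_mset j None)" for j
    by (simp add: G_def homog_deriv_replicate_None[OF E(1)])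
  have euler: "(\<Sum>w\<in>?V. homog_deriv E c (add_mset w K)) = (real (card E) - real (size K)) * homog_deriv E c K"
    if "set_mset K \<subseteq> ?V" for K
    using E(1) that homog_exponent_props[OF E(1)] by (intro Euler_deriv_at_one) auto
  \<comment> \<open>The derivative of order \<open>b + 1\<close> has degree
    \<open>card E - (b + 1) = k\<close>; this is the Euler factor.\<close>
  have row: "(\<Sum>v\<in>?V. h u v) = k * homog_deriv E c (add_mset u M)" if "u \<in> ?V" for u
    using euler[of "add_mset u M"] that M b by (simp add: h_def add_mset_commute[of u])
  have rows: "(\<Sum>u\<in>?V. \<Sum>v\<in>?V. h u v) = k * ((k + 1) * G b)"
    using euler[OF M(1)] M(2) b by (simp add: row G flip: sum_distrib_left) (simp add: M_def)
  have "hyperbolic_at_one ?V h"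
    unfolding h_def[abs_def] using E M b k by (intro homog_hyperbolic) auto
  \<comment> \<open>The test vector is the unit vector of \<open>None\<close>. Both sides then carry
    a common factor \<open>k\<close>, which is cancelled at the end.\<close>
  then have "(\<Sum>u\<in>?V. \<Sum>v\<in>?V. h u v * of_bool (u = None) * of_bool (v = None)) * (\<Sum>u\<in>?V. \<Sum>v\<in>?V. h u v)
     \<le> (\<Sum>u\<in>?V. (\<Sum>v\<in>?V. h u v) * of_bool (u = None))\<^sup>2"
    unfolding hyperbolic_at_one_def by (rule spec[where x = "\<lambda>u. of_bool (u = None)"])
  also have "(\<Sum>u\<in>?V. \<Sum>v\<in>?V. h u v * of_bool (u = None) * of_bool (v = None)) = G (Suc (Suc b))"
    unfolding sum_homog_vars[OF E(1)] by (simp add: h_def M_def G)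
  also have "(\<Sum>u\<in>?V. (\<Sum>v\<in>?V. h u v) * of_bool (u = None)) = (\<Sum>v\<in>?V. h None v)"
    unfolding sum_homog_vars[OF E(1), of "\<lambda>u. (\<Sum>v\<in>?V. h u v) * of_bool (u = None)"] by simp
  also have "\<dots> = k * G (Suc b)"
    by (subst row) (simp_all add: G M_def)
  finally have "k * ((k + 1) * G (Suc (Suc b)) * G b) \<le> k * (k * (G (Suc b))\<^sup>2)"
    unfolding rows by (simp add: power2_eq_square mult_ac)
  then have "(k + 1) * G (Suc (Suc b)) * G b \<le> k * (G (Suc b))\<^sup>2"
    using k by (simp only: mult_le_cancel_left_pos of_nat_0_less_iff)
  then show ?thesis unfolding b(1,2) by (simp add: b_def)
qed

section \<open>Ultra-log-concavity\<close>

text \<open>Dropping and swapping both preserve the sum of the two cardinalities, so both sides of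
  the exchange inequality acquire the same power of \<open>t\<close>.\<close>

lemma multiplicative_exchange_rescale:
  assumes E: "finite E" and exch: "multiplicative_exchange E c" and t: "t > 0"
  shows "multiplicative_exchange E (\<lambda>I. c I * t ^ card I)"
  unfolding multiplicative_exchange_def
proof (intro conjI allI impI)
  fix I assume "I \<subseteq> E"
  then show "0 \<le> c I * t ^ card I" using c_nonneg[OF E exch] t by simp
next
  fix I1 I2 i
  assume sub: "I1 \<subseteq> E" "I2 \<subseteq> E" and i: "i \<in> I1 - I2"
  have fin: "finite I1" "finite I2" using sub E finite_subset by auto
  have scale: "(c I1 * t ^ card I1) * (c I2 * t ^ card I2) \<le> (c A * t ^ card A) * (c B * t ^ card B)"
    if "c I1 * c I2 \<le> c A * c B" "card A + card B = card I1 + card I2" for A B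
  proof -
    have "t ^ card A * t ^ card B = t ^ card I1 * t ^ card I2"
      using that(2) by (simp flip: power_add)
    moreover have "(c I1 * c I2) * (t ^ card I1 * t ^ card I2) \<le> (c A * c B) * (t ^ card I1 * t ^ card I2)"
      using that(1) t by (intro mult_right_mono) auto
    ultimately show ?thesis by (simp add: mult_ac)
  qed
  have i': "i \<in> I1" "i \<notin> I2" using i by auto
  have c1: "Suc (card (I1 - {i})) = card I1" using fin(1) i'(1) by (rule card_Suc_Diff1)
  show "c I1 * t ^ card I1 * (c I2 * t ^ card I2)
         \<le> c (I1 - {i}) * t ^ card (I1 - {i}) * (c (insert i I2) * t ^ card (insert i I2)) \<or>
     (\<exists>j\<in>I2 - I1. c I1 * t ^ card I1 * (c I2 * t ^ card I2)
         \<le> c (insert j (I1 - {i})) * t ^ card (insert j (I1 - {i})) *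
           (c (insert i (I2 - {j})) * t ^ card (insert i (I2 - {j}))))" (is "?A \<or> ?B")
  proof (rule exchange_cases[OF E exch sub i'])
    assume "c I1 * c I2 \<le> c (I1 - {i}) * c (insert i I2)"
    then have ?A by (rule scale) (use fin i' c1 in simp)
    then show ?thesis ..
  next
    fix j assume j: "j \<in> I2" "j \<notin> I1" and le: "c I1 * c I2 \<le> c (insert j (I1 - {i})) * c (insert i (I2 - {j}))"
    have "Suc (card (I2 - {j})) = card I2" using fin(2) j(1) by (rule card_Suc_Diff1)
    then have "card (insert j (I1 - {i})) = card I1" "card (insert i (I2 - {j})) = card I2"
      using fin i' j c1 by (simp_all add: card_insert_disjoint)
    then have "card (insert j (I1 - {i})) + card (insert i (I2 - {j})) = card I1 + card I2" by simp
    from scale[OF le this] j have ?B by blast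
    then show ?thesis ..
  qed
qed

text \<open>Evaluating at \<open>x\<^sub>0 = s\<close> and letting \<open>s\<close> tend to \<open>0\<close> isolates the top coefficient of each derivative.\<close>

lemma multiplicative_exchange_ultra_log_concave:
  fixes c :: "'a set \<Rightarrow> real"
  assumes E: "finite E" "multiplicative_exchange E c" and k: "0 < k" "k < card E"
  defines "C \<equiv> \<lambda>j. \<Sum>I | I \<subseteq> E \<and> card I = j. c I"
  shows "(1 + 1 / k) * (1 + 1 / (card E - k)) * C (k - 1) * C (k + 1) \<le> (C k)\<^sup>2"
proof -
  define n where "n = card E"
  \<comment> \<open>This is \<open>s ^ j\<close> times the derivative of order \<open>n - j\<close>
    for the coefficients rescaled by \<open>1 / s\<close>, hence a polynomial in \<open>s\<close>.
    The truncated exponent does no harm: if \<open>card I > j\<close>, the falling factorial is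
    zero. At \<open>s = 0\<close> only sets with \<open>card I = j\<close> survive.\<close>
  define p where "p j s = (\<Sum>I\<in>Pow E. c I * (s ^ (j - card I) * ffall (n - card I) (n - j)))" for j and s :: real
  have card_le: "card I \<le> n" if "I \<subseteq> E" for I using that E(1) card_mono n_def by blast
  have p_scale: "(\<Sum>I\<in>Pow E. c I * (1 / s) ^ card I * ffall (card E - card I) (n - j)) * s ^ j = p j s"
    if "s > 0" "j \<le> n" for j s
    unfolding p_def sum_distrib_right
  proof (intro sum.cong refl)
    fix I assume "I \<in> Pow E"
    then have cI: "card I \<le> n" using card_le by blast
    show "c I * (1 / s) ^ card I * ffall (card E - card I) (n - j) * s ^ j =
        c I * (s ^ (j - card I) * ffall (n - card I) (n - j))"
    proof (cases "card I \<le> j")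
      case True
      then have "s ^ j = s ^ (j - card I) * s ^ card I" by (simp flip: power_add)
      then show ?thesis using \<open>s > 0\<close> by (simp add: n_def power_divide)
    next
      case False
      then have "ffall (n - card I) (n - j) = 0" using cI that by (intro ffall_eq_0) linarith
      then show ?thesis by (simp add: n_def)
    qed
  qed
  have p0: "p j 0 = fact (n - j) * C j" if "j \<le> n" for j
  proof -
    have "p j 0 = (\<Sum>I\<in>{I. I \<subseteq> E \<and> card I = j}. c I * fact (n - j))"
      unfolding p_def
    proof (rule sum.mono_neutral_cong_right)
      show "\<forall>I\<in>Pow E - {I. I \<subseteq> E \<and> card I = j}. c I * (0 ^ (j - card I) * ffall (n - card I) (n - j)) = 0"
      proof
        fix I assume I: "I \<in> Pow E - {I. I \<subseteq> E \<and> card I = j}"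
        show "c I * (0 ^ (j - card I) * ffall (n - card I) (n - j)) = 0"
        proof (cases "card I < j")
          case False
          then have "ffall (n - card I) (n - j) = 0"
            using I card_le[of I] by (intro ffall_eq_0) auto
          then show ?thesis by simp
        qed simp
      qed
    qed (use E in \<open>auto simp: ffall_self\<close>)
    then show ?thesis by (simp add: C_def sum_distrib_left mult.commute)
  qed
  \<comment> \<open>For \<open>s > 0\<close> the rescaled coefficients give
    \<open>f s \<ge> 0\<close>; continuity carries this to \<open>s = 0\<close>.\<close>
  define f where "f s = k * (p k s)\<^sup>2 - (k + 1) * p (k - 1) s * p (k + 1) s" for s
  have "continuous_on UNIV f"
    unfolding f_def p_def by (intro continuous_intros)
  then have "isCont f 0" by (simp add: continuous_on_eq_continuous_at)
  then have "(f \<longlongrightarrow> f 0) (at_right 0)"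
    by (simp add: isCont_def filterlim_at_split)
  moreover have "f s \<ge> 0" if "s > 0" for s
  proof -
    define G where "G b = (\<Sum>I\<in>Pow E. c I * (1 / s) ^ card I * ffall (card E - card I) b)" for b
    have ps: "p j s = G (n - j) * s ^ j" if "j \<le> n" for j
      using p_scale[OF \<open>s > 0\<close> that] by (simp add: G_def)
    have le: "(k + 1) * G (card E - k + 1) * G (card E - k - 1) \<le> k * (G (card E - k))\<^sup>2"
      unfolding G_def using that E k
      by (intro homog_deriv_None_log_concave multiplicative_exchange_rescale) auto
    \<comment> \<open>The powers of \<open>s\<close> balance: both products in \<open>f\<close>
      carry \<open>s ^ (2 * k)\<close> in total.\<close>
    have e: "k - 1 + (k + 1) = 2 * k" using k by simp
    from le have "((k + 1) * G (n - (k - 1)) * G (n - (k + 1))) * s ^ (2 * k) \<le> (k * (G (n - k))\<^sup>2) * s ^ (2 * k)"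
      using that k by (intro mult_right_mono) (simp_all add: n_def Suc_diff_le)
    also have "s ^ (2 * k) = s ^ (k - 1) * s ^ (k + 1)"
      by (simp only: e power_add[symmetric])
    also have "(k * (G (n - k))\<^sup>2) * (s ^ (k - 1) * s ^ (k + 1)) = k * (G (n - k) * s ^ k)\<^sup>2"
      by (simp only: e power_add[symmetric] power_mult_distrib power_even_eq mult.assoc)
    finally show ?thesis
      using k by (simp add: f_def ps n_def mult_ac)
  qed
  then have "eventually (\<lambda>s. f s \<ge> 0) (at_right 0)"
    by (intro eventually_at_rightI[of 0 1]) auto
  ultimately have "f 0 \<ge> 0"
    by (intro tendsto_lowerbound[where F = "at_right 0"]) auto
  then have le: "(k + 1) * (fact (n - (k - 1)) * C (k - 1)) * (fact (n - (k + 1)) * C (k + 1))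
      \<le> k * (fact (n - k) * C k)\<^sup>2"
    using k by (simp add: f_def p0 n_def)
  define m where "m = n - k"
  have m: "m \<ge> 1" "n - (k - 1) = Suc m" "n - (k + 1) = m - 1" "n - k = m"
    using k by (auto simp: m_def n_def)
  have fact_m: "fact m = real m * fact (m - 1)" using m(1) by (intro fact_reduce) simp
  \<comment> \<open>Cancelling \<open>fact m * fact (m - 1)\<close> leaves the factors
    \<open>m + 1\<close> on the left and \<open>m\<close> on the right, the source of
    \<open>1 + 1 / m\<close>.\<close>
  have "(fact m * fact (m - 1)) * ((k + 1) * (m + 1) * (C (k - 1) * C (k + 1)))
      \<le> (fact m * fact (m - 1)) * (k * m * (C k)\<^sup>2)"
    using le unfolding m by (simp add: fact_m power2_eq_square algebra_simps)
  then have "(k + 1) * (m + 1) * (C (k - 1) * C (k + 1)) \<le> k * m * (C k)\<^sup>2"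
    by (subst (asm) mult_le_cancel_left_pos) auto
  then have "(1 + 1 / k) * (1 + 1 / m) * C (k - 1) * C (k + 1) \<le> (C k)\<^sup>2"
    using k m(1) by (simp add: field_simps)
  then show ?thesis using k by (simp add: m_def n_def of_nat_diff)
qed

section \<open>From exponents to coefficients\<close>

lemma qpow_neg_nonneg: "qpow_neg q v \<ge> 0"
  by (cases v) (simp_all add: qpow_neg_def)

text \<open>For a base of at most 1 the power with negated exponent is monotone. If an exponent on
  the left is \<open>-\<infinity>\<close>, the left product is zero; otherwise the assumed
  inequality makes the exponents on the right finite too.\<close>

lemma qpow_neg_mult_mono:
  assumes "a + b \<le> a' + b'" "a \<noteq> \<infinity>" "b \<noteq> \<infinity>" "a' \<noteq> \<infinity>" "b' \<noteq> \<infinity>" "0 < q" "q \<le> 1"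
  shows "qpow_neg q a * qpow_neg q b \<le> qpow_neg q a' * qpow_neg q b'"
proof (cases "a = - \<infinity> \<or> b = - \<infinity>")
  case True
  then have "qpow_neg q a * qpow_neg q b = 0" by (auto simp: qpow_neg_def)
  moreover have "0 \<le> qpow_neg q a' * qpow_neg q b'" by (simp add: qpow_neg_nonneg)
  ultimately show ?thesis by linarith
next
  case False
  then obtain r s where rs: "a = ereal r" "b = ereal s" using assms by (cases a; cases b) auto
  then obtain r' s' where rs': "a' = ereal r'" "b' = ereal s'" using assms by (cases a'; cases b') auto
  have "q powr (- r - s) \<le> q powr (- r' - s')"
    using assms rs rs' by (intro powr_mono') auto
  then show ?thesis by (simp add: qpow_neg_def rs rs' flip: powr_add)
qed

lemma M_natural_concave_imp_multiplicative_exchange: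
  assumes \<nu>: "M_natural_concave E \<nu>" and q: "0 < q" "q \<le> 1"
  shows "multiplicative_exchange E (\<lambda>I. qpow_neg q (\<nu> I))"
  unfolding multiplicative_exchange_def
proof (intro conjI allI impI)
  fix I1 I2 i
  assume sub: "I1 \<subseteq> E" "I2 \<subseteq> E" and i: "i \<in> I1 - I2"
  have fin: "\<nu> I \<noteq> \<infinity>" if "I \<subseteq> E" for I using \<nu> that by (auto simp: M_natural_concave_def)
  have "\<nu> I1 + \<nu> I2 \<le> \<nu> (I1 - {i}) + \<nu> (insert i I2) \<or>
        (\<exists>j \<in> I2 - I1. \<nu> I1 + \<nu> I2 \<le> \<nu> (insert j (I1 - {i})) + \<nu> (insert i (I2 - {j})))"
    using \<nu> sub i unfolding M_natural_concave_def by blast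
  then show "qpow_neg q (\<nu> I1) * qpow_neg q (\<nu> I2) \<le> qpow_neg q (\<nu> (I1 - {i})) * qpow_neg q (\<nu> (insert i I2)) \<or>
     (\<exists>j\<in>I2 - I1. qpow_neg q (\<nu> I1) * qpow_neg q (\<nu> I2)
        \<le> qpow_neg q (\<nu> (insert j (I1 - {i}))) * qpow_neg q (\<nu> (insert i (I2 - {j}))))"
  proof
    assume "\<nu> I1 + \<nu> I2 \<le> \<nu> (I1 - {i}) + \<nu> (insert i I2)"
    then show ?thesis using sub i q by (intro disjI1 qpow_neg_mult_mono fin) auto
  next
    assume "\<exists>j \<in> I2 - I1. \<nu> I1 + \<nu> I2 \<le> \<nu> (insert j (I1 - {i})) + \<nu> (insert i (I2 - {j}))"
    then obtain j where j: "j \<in> I2 - I1"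
      "\<nu> I1 + \<nu> I2 \<le> \<nu> (insert j (I1 - {i})) + \<nu> (insert i (I2 - {j}))" by blast
    show ?thesis
      using sub i q j by (intro disjI2 bexI[OF _ j(1)] qpow_neg_mult_mono[OF j(2)] fin) auto
  qed
qed (simp add: qpow_neg_nonneg)

theorem theorem1p4:
  fixes E :: "'a set" and \<nu> :: "'a set \<Rightarrow> ereal" and q :: real and k :: nat
  assumes "finite E" and "M_natural_concave E \<nu>"
    and "0 < k" and "k < card E"
    and "0 < q" and "q \<le> 1"
  shows "(I_qnu E q \<nu> k)\<^sup>2 \<ge>
    (1 + 1 / real k) * (1 + 1 / real (card E - k)) *
      I_qnu E q \<nu> (k - 1) * I_qnu E q \<nu> (k + 1)"
  unfolding I_qnu_def
  using multiplicative_exchange_ultra_log_concave[OF assms(1)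
      M_natural_concave_imp_multiplicative_exchange[OF assms(2,5,6)] assms(3,4)] .

end
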